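(* Let $\beta>1$ and $\xi\in[0,1]$, and suppose $\mathrm{Diam}_\beta(\xi)\le 1/\beta$. Then one of the following holds. (a) $\overline{d}_\beta(\xi)$ is a Sturmian word of slope $\le\mathrm{Freq}(\beta)$, and $\mathrm{Diam}_\beta(\xi)=1/\beta$. (b) For some rational $p/q\le\mathrm{Freq}(\beta)$ (with $\gcd(p,q)=1$, $q\ge1$), $\overline{d}_\beta(\xi)$ is a mechanical word of slope $p/q$, and $\mathrm{Diam}_\beta(\xi)=\frac{\beta^{q-1}-1}{\beta^q-1}$. (c) For some rational $p/q\le\mathrm{Freq}(\beta)$ (with $\gcd(p,q)=1$, $q\ge1$), $\overline{d}_\beta(\xi)$ is a skew word of slope $p/q$, and $\mathrm{Diam}_\beta(\overline{T}_\beta^k(\xi))=\frac{\beta^{q-1}-1}{\beta^q-1}$ for all sufficiently large $k$.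
   Context: Define $\langle t\rangle=\{t\}$ (fractional part) if $t\notin\mathbb{Z}$ and $\langle t\rangle=1$ if $t\in\mathbb{Z}$. For $\beta>1$, $\overline{T}_\beta(x)=\langle\beta x\rangle$ on $[0,1]$, and the $\overline{\beta}$-expansion of $x\in[0,1]$ is $\overline{d}_\beta(x)=(x_i)_{i\ge1}$ with $x_i=\lceil\beta\overline{T}_\beta^{i-1}(x)\rceil-1$. For $\xi\in[0,1]$, $\mathrm{Diam}_\beta(\xi)=\sup_{n\ge0}\overline{T}_\beta^n(\xi)-\inf_{n\ge0}\overline{T}_\beta^n(\xi)$. A $\overline{T}_\beta$-orbit closure is the closure of $\{\overline{T}_\beta^n(x):n\ge0\}$; it is invariant if $\overline{T}_\beta(S)=S$. The frequency of $x$ is $\lim_{n\to\infty}\frac1n\sum_{k=1}^na_k$ where $\overline{d}_\beta(x)=a_1a_2\cdots$. Mechanical words: for real $\alpha\ge0$, $\rho\in[0,1]$, $s_{\alpha,\rho}$ and $s'_{\alpha,\rho}$ are the infinite words with $n$-th letters ($n\ge0$) $\lfloor\alpha(n+1)+\rho\rfloor-\lfloor\alpha n+\rho\rfloor$ and $\lceil\alpha(n+1)+\rho\rceil-\lceil\alpha n+\rho\rceil$; $\alpha$ is the slope. A Sturmian word is a mechanical word of irrational slope. A binary word is balanced if for any two factors $u,v$ of equal length the numbers of occurrences of a given letter in $u$ and $v$ differ by at most 1; a skew word is an infinite balanced binary word that is not recurrent; it is, after a nonempty prefix, a mechanical word of some rational slope, called the slope of the skew word. $\mathrm{Freq}$: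 for integer $\beta\ge2$, $\mathrm{Freq}(\beta)=\beta-1$; for non-integer $\beta>1$, $\mathrm{Freq}(\beta)$ is the frequency of the unique invariant $\overline{T}_\beta$-orbit closure contained in the interval $[1-\frac1\beta,1]$. *)

theory Defs
  imports "HOL-Analysis.Analysis"
begin

definition upper_frac :: "real \<Rightarrow> real" where
  "upper_frac t = (if t \<in> \<int> then 1 else frac t)"

definition Tbar :: "real \<Rightarrow> real \<Rightarrow> real" where
  "Tbar \<beta> x = upper_frac (\<beta> * x)"

text \<open>Infinite words are functions on the naturals indexed from 0, so \<open>dbar \<beta> x n\<close> is the
  digit \<open>x\<^sub>n\<^sub>+\<^sub>1\<close> of the usual one-based expansion.\<close>

definition dbar :: "real \<Rightarrow> real \<Rightarrow> nat \<Rightarrow> int" where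
  "dbar \<beta> x n = \<lceil>\<beta> * (Tbar \<beta> ^^ n) x\<rceil> - 1"

definition Diam :: "real \<Rightarrow> real \<Rightarrow> real" where
  "Diam \<beta> \<xi> = (SUP n. (Tbar \<beta> ^^ n) \<xi>) - (INF n. (Tbar \<beta> ^^ n) \<xi>)"

definition orbit_closure :: "real \<Rightarrow> real set \<Rightarrow> bool" where
  "orbit_closure \<beta> S \<longleftrightarrow> (\<exists>x\<in>{0..1}. S = closure (range (\<lambda>n. (Tbar \<beta> ^^ n) x)))"

definition Tbar_invariant :: "real \<Rightarrow> real set \<Rightarrow> bool" where
  "Tbar_invariant \<beta> S \<longleftrightarrow> Tbar \<beta> ` S = S"

definition has_frequency :: "real \<Rightarrow> real \<Rightarrow> real \<Rightarrow> bool" where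
  "has_frequency \<beta> x f \<longleftrightarrow>
     (\<lambda>n. (1 / real n) * (\<Sum>k<n. real_of_int (dbar \<beta> x k))) \<longlonglongrightarrow> f"

text \<open>The frequency of a set is the common frequency of its points.\<close>

definition set_frequency :: "real \<Rightarrow> real set \<Rightarrow> real" where
  "set_frequency \<beta> S = (THE f. \<forall>x\<in>S. has_frequency \<beta> x f)"

definition Freq :: "real \<Rightarrow> real" where
  "Freq \<beta> =
     (if \<beta> \<in> \<int> then \<beta> - 1
      else set_frequency \<beta>
             (THE S. orbit_closure \<beta> S \<and> Tbar_invariant \<beta> S \<and> S \<subseteq> {1 - 1 / \<beta>..1}))"

definition lower_mechanical :: "real \<Rightarrow> real \<Rightarrow> nat \<Rightarrow> int" where
  "lower_mechanical \<alpha> \<rho> n = \<lfloor>\<alpha> * (real n + 1) + \<rho>\<rfloor> - \<lfloor>\<alpha> * real n + \<rho>\<rfloor>"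

definition upper_mechanical :: "real \<Rightarrow> real \<Rightarrow> nat \<Rightarrow> int" where
  "upper_mechanical \<alpha> \<rho> n = \<lceil>\<alpha> * (real n + 1) + \<rho>\<rceil> - \<lceil>\<alpha> * real n + \<rho>\<rceil>"

definition mechanical_word :: "real \<Rightarrow> (nat \<Rightarrow> int) \<Rightarrow> bool" where
  "mechanical_word \<alpha> w \<longleftrightarrow>
     \<alpha> \<ge> 0 \<and> (\<exists>\<rho>\<in>{0..1}. w = lower_mechanical \<alpha> \<rho> \<or> w = upper_mechanical \<alpha> \<rho>)"

definition sturmian_word :: "real \<Rightarrow> (nat \<Rightarrow> int) \<Rightarrow> bool" where
  "sturmian_word \<alpha> w \<longleftrightarrow> \<alpha> \<notin> \<rat> \<and> mechanical_word \<alpha> w"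

definition word_factor :: "(nat \<Rightarrow> 'a) \<Rightarrow> nat \<Rightarrow> nat \<Rightarrow> 'a list" where
  "word_factor w i m = map w [i..<i + m]"

text \<open>The two letters are consecutive integers, as they are for every mechanical word; this is
  what makes a skew word eventually mechanical.\<close>

definition binary_word :: "(nat \<Rightarrow> int) \<Rightarrow> bool" where
  "binary_word w \<longleftrightarrow> (\<exists>a. range w \<subseteq> {a, a + 1})"

definition balanced_word :: "(nat \<Rightarrow> 'a) \<Rightarrow> bool" where
  "balanced_word w \<longleftrightarrow>
     (\<forall>m i j c. \<bar>int (count_list (word_factor w i m) c) - int (count_list (word_factor w j m) c)\<bar> \<le> 1)"

definition recurrent_word :: "(nat \<Rightarrow> 'a) \<Rightarrow> bool" where
  "recurrent_word w \<longleftrightarrow> (\<forall>i m. infinite {j. word_factor w j m = word_factor w i m})"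

definition skew_word :: "(nat \<Rightarrow> int) \<Rightarrow> bool" where
  "skew_word w \<longleftrightarrow> binary_word w \<and> balanced_word w \<and> \<not> recurrent_word w"

definition skew_word_of_slope :: "real \<Rightarrow> (nat \<Rightarrow> int) \<Rightarrow> bool" where
  "skew_word_of_slope \<alpha> w \<longleftrightarrow>
     skew_word w \<and> \<alpha> \<in> \<rat> \<and> (\<exists>k\<ge>1. mechanical_word \<alpha> (\<lambda>n. w (n + k)))"

end

theory Submission
  imports Defs
begin

text \<open>
  If the orbit of \<open>\<xi>\<close> fits into an interval of length \<open>1/\<beta>\<close>, any two digit blocks of equal length have
  sums differing by at most 1, so the digits have a slope \<open>\<alpha>\<close> and the deviations of the digit sums
  from \<open>n\<alpha>\<close> stay in a window of length 1. If no two deviations differ by exactly 1, the word is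
  mechanical; otherwise \<open>\<alpha>\<close> is rational, the deviation makes its jump of size 1 in one direction only,
  and the word is skew with a mechanical tail.

  By Abel summation each orbit point is a monotone function of its digit sums. Comparing these with
  \<open>\<lfloor>k\<alpha>\<rfloor>\<close> and \<open>\<lceil>k\<alpha>\<rceil>\<close> shows that the supremum of the orbit is at least \<open>(1 - 1/\<beta>) \<Sum> \<lceil>k\<alpha>\<rceil> \<beta>\<^bsup>-k\<^esup>\<close> and the
  infimum at most \<open>(1 - 1/\<beta>) \<Sum> \<lfloor>k\<alpha>\<rfloor> \<beta>\<^bsup>-k\<^esup>\<close>, with equality for mechanical words; the difference of
  the two series is the diameter.

  For non-integer \<open>\<beta>\<close>, \<open>Freq \<beta>\<close> is the largest \<open>\<alpha>\<close> for which the first series is at most 1: its value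
  at this \<open>\<alpha>\<close> is a point whose orbit closure is the unique invariant one in \<open>[1 - 1/\<beta>, 1]\<close>.
\<close>

section \<open>Balanced integer words\<close>

definition bsum :: "(nat \<Rightarrow> int) \<Rightarrow> nat \<Rightarrow> nat \<Rightarrow> int" where
  "bsum d i n = (\<Sum>k<n. d (i + k))"

text \<open>Balance of block sums makes sense before the alphabet is known;
  \<open>sum_balanced_binary\<close> and \<open>sum_balanced_imp_balanced_word\<close> lead from it
  to letter counts.\<close>

definition sum_balanced :: "(nat \<Rightarrow> int) \<Rightarrow> bool" where
  "sum_balanced d \<longleftrightarrow> (\<forall>i j n. \<bar>bsum d i n - bsum d j n\<bar> \<le> 1)"

text \<open>The bound is uniform in the starting position, so it passes to tails; the limit of
  averages is derived from it in \<open>has_slope_frequency\<close>.\<close>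

definition has_slope :: "(nat \<Rightarrow> int) \<Rightarrow> real \<Rightarrow> bool" where
  "has_slope d \<alpha> \<longleftrightarrow> (\<forall>i n. \<bar>real_of_int (bsum d i n) - real n * \<alpha>\<bar> \<le> 1)"

lemma bsum_0 [simp]: "bsum d i 0 = 0"
  by (simp add: bsum_def)

lemma bsum_Suc: "bsum d i (Suc n) = bsum d i n + d (i + n)"
  by (simp add: bsum_def)

lemma bsum_add: "bsum d i (m + n) = bsum d i m + bsum d (i + m) n"
  by (induction n) (simp_all add: bsum_Suc add.assoc)

lemma bsum_Suc_left: "bsum d i (Suc n) = d i + bsum d (Suc i) n"
  using bsum_add[of d i 1 n] by (simp add: bsum_def)

lemma bsum_shift: "bsum (\<lambda>n. d (n + k)) i n = bsum d (i + k) n"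
  unfolding bsum_def by (rule sum.cong) (simp_all add: ac_simps)

lemma bsum_uminus: "bsum (\<lambda>n. - d n) i n = - bsum d i n"
  by (simp add: bsum_def sum_negf)

text \<open>The block is cut into \<open>k\<close> consecutive blocks of length
  \<open>n\<close>.\<close>

lemma bsum_mult_ge:
  assumes "\<And>j. c \<le> real_of_int (bsum d j n)"
  shows "real k * c \<le> real_of_int (bsum d i (k * n))"
proof (induction k)
  case (Suc k)
  have "bsum d i (Suc k * n) = bsum d i (k * n) + bsum d (i + k * n) n"
    by (metis add.commute bsum_add mult_Suc)
  with Suc assms[of "i + k * n"] show ?case by (simp add: algebra_simps)
qed simp

lemma bsum_mult_le:
  assumes "\<And>j. real_of_int (bsum d j n) \<le> c"
  shows "real_of_int (bsum d i (k * n)) \<le> real k * c"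
  using bsum_mult_ge[of "- c" "\<lambda>n. - d n" n k i] assms by (simp add: bsum_uminus)

lemma sum_balanced_le:
  assumes "sum_balanced d"
  shows "real_of_int (bsum d i n) \<le> real_of_int (bsum d j n) + 1"
proof -
  have "bsum d i n \<le> bsum d j n + 1"
    using assms[unfolded sum_balanced_def, rule_format, of i n j] by simp
  thus ?thesis by linarith
qed

text \<open>Negating the letters swaps floors with ceilings and rises with falls, so that one-sided
  results can be transferred to the other side.\<close>

lemma sum_balanced_uminus: "sum_balanced d \<Longrightarrow> sum_balanced (\<lambda>n. - d n)"
  unfolding sum_balanced_def bsum_uminus by (simp add: abs_minus_commute)

lemma has_slope_uminus: "has_slope d \<alpha> \<Longrightarrow> has_slope (\<lambda>n. - d n) (- \<alpha>)"
  unfolding has_slope_def bsum_uminus by (simp add: abs_minus_commute)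

lemma has_slope_shift: "has_slope d \<alpha> \<Longrightarrow> has_slope (\<lambda>n. d (n + k)) \<alpha>"
  unfolding has_slope_def bsum_shift by simp

text \<open>Every quotient (sum - 1) / length is at most every quotient (sum + 1) / length, and a
  number separating the two families is a slope.\<close>

lemma sum_balanced_imp_slope:
  assumes bal: "sum_balanced d"
  obtains \<alpha> where "has_slope d \<alpha>"
proof -
  \<comment> \<open>A block of length \<open>k * n\<close> is cut once into blocks of length
    \<open>n\<close> and once into blocks of length \<open>k\<close>.\<close>
  have cross: "(real_of_int (bsum d i n) - 1) / real n \<le> (real_of_int (bsum d j k) + 1) / real k"
    if "n > 0" "k > 0" for i n j k
  proof -
    have "real k * (real_of_int (bsum d i n) - 1) \<le> real_of_int (bsum d 0 (k * n))"
      by (rule bsum_mult_ge) (use sum_balanced_le[OF bal] in \<open>simp add: algebra_simps\<close>)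
    also have "\<dots> = real_of_int (bsum d 0 (n * k))" by (simp add: mult.commute)
    also have "\<dots> \<le> real n * (real_of_int (bsum d j k) + 1)"
      by (rule bsum_mult_le) (use sum_balanced_le[OF bal] in simp)
    finally show ?thesis using that by (simp add: field_simps)
  qed
  define A where "A = {(real_of_int (bsum d i n) - 1) / real n |i n. n > 0}"
  have ne: "A \<noteq> {}" unfolding A_def by auto
  have ub: "y \<le> (real_of_int (bsum d j k) + 1) / real k" if "y \<in> A" "k > 0" for y j k
    using that cross unfolding A_def by auto
  have bdd: "bdd_above A" using ub[of _ 1 0] by (intro bdd_aboveI[of A]) auto
  have "\<bar>real_of_int (bsum d i n) - real n * Sup A\<bar> \<le> 1" for i n
  proof (cases "n = 0")
    case False
    hence "(real_of_int (bsum d i n) - 1) / real n \<le> Sup A"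
      by (intro cSup_upper bdd) (auto simp: A_def)
    moreover have "Sup A \<le> (real_of_int (bsum d i n) + 1) / real n"
      by (rule cSup_least[OF ne]) (use ub False in auto)
    ultimately show ?thesis using False by (simp add: field_simps abs_le_iff)
  qed simp
  thus ?thesis using that by (auto simp: has_slope_def)
qed

text \<open>If \<open>c < \<alpha>\<close>, the gap \<open>n * (\<alpha> - c)\<close> outgrows the
  error 1 that a slope allows.\<close>

lemma has_slope_mono:
  assumes "has_slope d \<alpha>" "\<And>n. real_of_int (d n) \<le> c"
  shows "\<alpha> \<le> c"
proof (rule ccontr)
  assume "\<not> \<alpha> \<le> c"
  then obtain n :: nat where n: "real n * (\<alpha> - c) > 1"
    using reals_Archimedean3[of "\<alpha> - c"] by auto
  have "real_of_int (bsum d 0 n) \<le> real n * c"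
    using sum_bounded_above[of "{..<n}" "\<lambda>k. real_of_int (d k)" c] assms(2)
    by (simp add: bsum_def)
  moreover have "real n * \<alpha> \<le> real_of_int (bsum d 0 n) + 1"
    using assms(1)[unfolded has_slope_def, rule_format, of 0 n] by simp
  ultimately show False using n by (simp add: algebra_simps)
qed

lemma has_slope_nonneg:
  assumes "has_slope d \<alpha>" "\<And>n. 0 \<le> d n"
  shows "0 \<le> \<alpha>"
  using has_slope_mono[OF has_slope_uminus[OF assms(1)], of 0] assms(2) by simp

lemma has_slope_frequency:
  assumes "has_slope d \<alpha>"
  shows "(\<lambda>n. (1 / real n) * (\<Sum>k<n. real_of_int (d k))) \<longlonglongrightarrow> \<alpha>"
proof -
  have "\<bar>(1 / real n) * (\<Sum>k<n. real_of_int (d k)) - \<alpha>\<bar> \<le> 1 / real n" if "n > 0" for n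
  proof -
    have "\<bar>real_of_int (bsum d 0 n) - real n * \<alpha>\<bar> \<le> 1"
      using assms by (auto simp: has_slope_def)
    moreover have "(1 / real n) * (\<Sum>k<n. real_of_int (d k)) - \<alpha>
        = (real_of_int (bsum d 0 n) - real n * \<alpha>) / real n"
      using that by (simp add: bsum_def field_simps)
    ultimately show ?thesis using that by (simp add: field_simps abs_le_iff)
  qed
  hence "(\<lambda>n. (1 / real n) * (\<Sum>k<n. real_of_int (d k)) - \<alpha>) \<longlonglongrightarrow> 0"
    by (intro Lim_null_comparison[OF _ lim_1_over_n]) (auto intro!: eventually_sequentiallyI[of 1])
  thus ?thesis by (rule LIM_zero_cancel)
qed

section \<open>Mechanical words and deviations from the slope\<close>

lemma bsum_lower_mechanical:
  "bsum (lower_mechanical \<alpha> \<rho>) i n = \<lfloor>\<alpha> * real (i + n) + \<rho>\<rfloor> - \<lfloor>\<alpha> * real i + \<rho>\<rfloor>"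
  by (induction n) (simp_all add: bsum_Suc lower_mechanical_def algebra_simps)

lemma bsum_upper_mechanical:
  "bsum (upper_mechanical \<alpha> \<rho>) i n = \<lceil>\<alpha> * real (i + n) + \<rho>\<rceil> - \<lceil>\<alpha> * real i + \<rho>\<rceil>"
  by (induction n) (simp_all add: bsum_Suc upper_mechanical_def algebra_simps)

text \<open>Block sums telescope to a difference of two floors or two ceilings, and the bounds for
  such a difference do not involve the intercept.\<close>

lemma mechanical_word_bsum:
  assumes "mechanical_word \<alpha> d"
  shows "\<lfloor>real k * \<alpha>\<rfloor> \<le> bsum d n k" "bsum d n k \<le> \<lceil>real k * \<alpha>\<rceil>"
proof -
  obtain \<rho> where \<rho>: "d = lower_mechanical \<alpha> \<rho> \<or> d = upper_mechanical \<alpha> \<rho>"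
    using assms by (auto simp: mechanical_word_def)
  have eq: "\<alpha> * real (n + k) + \<rho> = (\<alpha> * real n + \<rho>) + real k * \<alpha>"
    by (simp add: algebra_simps)
  have fl: "\<lfloor>b\<rfloor> \<le> \<lfloor>a + b\<rfloor> - \<lfloor>a\<rfloor> \<and> \<lfloor>a + b\<rfloor> - \<lfloor>a\<rfloor> \<le> \<lceil>b\<rceil>" for a b :: real
    by linarith
  have ce: "\<lfloor>b\<rfloor> \<le> \<lceil>a + b\<rceil> - \<lceil>a\<rceil> \<and> \<lceil>a + b\<rceil> - \<lceil>a\<rceil> \<le> \<lceil>b\<rceil>" for a b :: real
    by linarith
  show "\<lfloor>real k * \<alpha>\<rfloor> \<le> bsum d n k" "bsum d n k \<le> \<lceil>real k * \<alpha>\<rceil>"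
    using \<rho> fl[of "real k * \<alpha>" "\<alpha> * real n + \<rho>"] ce[of "real k * \<alpha>" "\<alpha> * real n + \<rho>"]
    unfolding eq[symmetric] by (auto simp: bsum_lower_mechanical bsum_upper_mechanical)
qed

lemma lower_mechanicalI:
  assumes "\<And>n. bsum d 0 n = \<lfloor>\<alpha> * real n + \<rho>\<rfloor>"
  shows "d = lower_mechanical \<alpha> \<rho>"
proof
  fix n
  have "d n = bsum d 0 (Suc n) - bsum d 0 n" by (simp add: bsum_Suc)
  also have "\<dots> = lower_mechanical \<alpha> \<rho> n"
    unfolding assms by (simp add: lower_mechanical_def algebra_simps)
  finally show "d n = lower_mechanical \<alpha> \<rho> n" .
qed

text \<open>The constant \<open>c\<close> cancels in the letters. The case \<open>n = 0\<close>
  forces \<open>c = \<lceil>\<rho>\<rceil>\<close>: it is 1 for an intercept in (0, 1] and 0 for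
  intercept 0.\<close>

lemma upper_mechanicalI:
  assumes "\<And>n. bsum d 0 n = \<lceil>\<alpha> * real n + \<rho>\<rceil> - c"
  shows "d = upper_mechanical \<alpha> \<rho>"
proof
  fix n
  have "d n = bsum d 0 (Suc n) - bsum d 0 n" by (simp add: bsum_Suc)
  also have "\<dots> = upper_mechanical \<alpha> \<rho> n"
    unfolding assms by (simp add: upper_mechanical_def algebra_simps)
  finally show "d n = upper_mechanical \<alpha> \<rho> n" .
qed

text \<open>The excess of a block sum over its expected value is a difference of two deviations, so
  under \<open>has_slope\<close> all deviations lie in one window of length 1.\<close>

definition deviation :: "(nat \<Rightarrow> int) \<Rightarrow> real \<Rightarrow> nat \<Rightarrow> real" where
  "deviation d \<alpha> n = real_of_int (bsum d 0 n) - real n * \<alpha>"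

lemma deviation_0 [simp]: "deviation d \<alpha> 0 = 0"
  by (simp add: deviation_def)

lemma deviation_diff:
  "deviation d \<alpha> (n + k) - deviation d \<alpha> n = real_of_int (bsum d n k) - real k * \<alpha>"
  using bsum_add[of d 0 n k] by (simp add: deviation_def algebra_simps)

lemma deviation_uminus: "deviation (\<lambda>n. - d n) (- \<alpha>) n = - deviation d \<alpha> n"
  by (simp add: deviation_def bsum_uminus)

lemma deviation_close:
  assumes "has_slope d \<alpha>"
  shows "deviation d \<alpha> n - deviation d \<alpha> m \<le> 1"
proof (cases "m \<le> n")
  case True
  then obtain k where "n = m + k" using le_Suc_ex by blast
  moreover have "\<bar>real_of_int (bsum d m k) - real k * \<alpha>\<bar> \<le> 1"
    using assms by (simp add: has_slope_def)
  ultimately show ?thesis using deviation_diff[of d \<alpha> m k] by simp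
next
  case False
  then obtain k where "m = n + k" using le_Suc_ex by (meson nat_le_linear)
  moreover have "\<bar>real_of_int (bsum d n k) - real k * \<alpha>\<bar> \<le> 1"
    using assms by (simp add: has_slope_def)
  ultimately show ?thesis using deviation_diff[of d \<alpha> n k] by simp
qed

lemma deviation_bdd:
  assumes "has_slope d \<alpha>"
  shows "bdd_above (range (deviation d \<alpha>))" "bdd_below (range (deviation d \<alpha>))"
proof -
  show "bdd_above (range (deviation d \<alpha>))"
    using deviation_close[OF assms, of _ 0] by (intro bdd_aboveI[of _ 1]) auto
  show "bdd_below (range (deviation d \<alpha>))"
    using deviation_close[OF assms, of 0] by (intro bdd_belowI[of _ "-1"]) fastforce
qed

text \<open>The intercept is the supremum \<open>\<rho>\<close> of the deviations, which lie in
  \<open>[\<rho> - 1, \<rho>]\<close>. If \<open>\<rho>\<close> is attained, then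
  \<open>\<rho> - 1\<close> is not, and the sums are floors; otherwise they are shifted
  ceilings.\<close>

lemma mechanical_wordI:
  assumes sl: "has_slope d \<alpha>" and nn: "0 \<le> \<alpha>"
    and ne: "\<And>n m. deviation d \<alpha> n \<noteq> deviation d \<alpha> m + 1"
  shows "mechanical_word \<alpha> d"
proof -
  define \<rho> where "\<rho> = (SUP n. deviation d \<alpha> n)"
  have up: "deviation d \<alpha> n \<le> \<rho>" for n
    unfolding \<rho>_def by (rule cSUP_upper[OF _ deviation_bdd(1)[OF sl]]) simp
  have lo: "\<rho> - 1 \<le> deviation d \<alpha> n" for n
  proof -
    have "\<rho> \<le> deviation d \<alpha> n + 1"
      unfolding \<rho>_def by (rule cSUP_least) (use deviation_close[OF sl] in \<open>auto simp: algebra_simps\<close>)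
    thus ?thesis by simp
  qed
  \<comment> \<open>The deviation at position 0 is 0, so the window contains 0.\<close>
  have \<rho>01: "\<rho> \<in> {0..1}" using up[of 0] lo[of 0] by simp
  have "d = lower_mechanical \<alpha> \<rho> \<or> d = upper_mechanical \<alpha> \<rho>"
  proof (cases "\<exists>m. deviation d \<alpha> m = \<rho>")
    case True
    then obtain m where m: "deviation d \<alpha> m = \<rho>" ..
    have "bsum d 0 n = \<lfloor>\<alpha> * real n + \<rho>\<rfloor>" for n
    proof -
      have "\<rho> - 1 < deviation d \<alpha> n" using lo[of n] ne[of m n] m by linarith
      thus ?thesis using up[of n] unfolding deviation_def
        by (intro floor_unique[symmetric]) (simp_all add: algebra_simps)
    qed
    thus ?thesis using lower_mechanicalI by blast
  next
    case False
    have "bsum d 0 n = \<lceil>\<alpha> * real n + \<rho>\<rceil> - 1" for n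
    proof -
      have "deviation d \<alpha> n < \<rho>" using up[of n] False by (metis less_eq_real_def)
      hence "\<lceil>\<alpha> * real n + \<rho>\<rceil> = bsum d 0 n + 1" using lo[of n] unfolding deviation_def
        by (intro ceiling_unique) (simp_all add: algebra_simps)
      thus ?thesis by simp
    qed
    thus ?thesis using upper_mechanicalI by blast
  qed
  thus ?thesis using nn \<rho>01 by (auto simp: mechanical_word_def)
qed

text \<open>By balance, blocks of length \<open>k\<close> have sum at least \<open>k\<alpha>\<close> and blocks of length \<open>l\<close> at most \<open>l\<alpha>\<close>; a block
  of length \<open>k l\<close> starting with an excessive block of length \<open>k\<close> violates one of the two.\<close>

lemma no_rise_and_fall:
  assumes bal: "sum_balanced d"
    and rise: "real_of_int (bsum d i k) = real k * \<alpha> + 1"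
    and fall: "real_of_int (bsum d j l) = real l * \<alpha> - 1"
  shows False
proof -
  have ge: "real k * \<alpha> \<le> real_of_int (bsum d n k)" for n
    using sum_balanced_le[OF bal, of i k n] rise by simp
  have le: "real_of_int (bsum d n l) \<le> real l * \<alpha>" for n
    using sum_balanced_le[OF bal, of n l j] fall by simp
  have "l \<noteq> 0" using fall by (intro notI) simp
  then obtain l' where l': "l = Suc l'" using not0_implies_Suc by blast
  have "bsum d i (l * k) = bsum d i k + bsum d (i + k) (l' * k)"
    by (simp add: l' bsum_add)
  moreover have "real l' * (real k * \<alpha>) \<le> real_of_int (bsum d (i + k) (l' * k))"
    by (rule bsum_mult_ge[OF ge])
  moreover have "real_of_int (bsum d i (k * l)) \<le> real k * (real l * \<alpha>)"
    by (rule bsum_mult_le[OF le])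
  ultimately show False
    using rise by (simp add: l' algebra_simps)
qed

lemma deviation_no_rise_and_fall:
  assumes bal: "sum_balanced d"
    and "n \<le> m" "deviation d \<alpha> m = deviation d \<alpha> n + 1"
    and "n' \<le> m'" "deviation d \<alpha> n' = deviation d \<alpha> m' + 1"
  shows False
proof -
  obtain k l where "m = n + k" "m' = n' + l" using assms le_Suc_ex by metis
  thus False using no_rise_and_fall[OF bal, of n k \<alpha> n' l] assms
      deviation_diff[of d \<alpha> n k] deviation_diff[of d \<alpha> n' l] by simp
qed

section \<open>Rises, recurrence and skew words\<close>

lemma bsum_word_factor_cong:
  assumes "word_factor d i m = word_factor d j m"
  shows "bsum d i m = bsum d j m"
proof -
  have "d (i + k) = d (j + k)" if "k < m" for k
    using arg_cong[OF assms, of "\<lambda>xs. xs ! k"] that by (simp add: word_factor_def)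
  thus ?thesis by (simp add: bsum_def)
qed

text \<open>A rise by 1 leads from the minimum of the window to its maximum. The minimum is never
  reached again, since that would be a fall by 1; a later copy of the block from \<open>n\<close> to
  \<open>m\<close> would therefore start above the minimum and end above the maximum.\<close>

lemma rise_not_recurrent:
  assumes bal: "sum_balanced d" and sl: "has_slope d \<alpha>"
    and nm: "n \<le> m" and rise: "deviation d \<alpha> m = deviation d \<alpha> n + 1"
  shows "\<not> recurrent_word d" "\<And>k. k \<ge> m \<Longrightarrow> deviation d \<alpha> n < deviation d \<alpha> k"
    "\<And>k. deviation d \<alpha> k \<le> deviation d \<alpha> m"
proof -
  show le: "deviation d \<alpha> k \<le> deviation d \<alpha> m" for k
    using deviation_close[OF sl, of k n] rise by simp
  show gt: "deviation d \<alpha> n < deviation d \<alpha> k" if "k \<ge> m" for k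
  proof (rule ccontr)
    assume "\<not> ?thesis"
    hence "deviation d \<alpha> k = deviation d \<alpha> n"
      using deviation_close[OF sl, of m k] rise by simp
    thus False using deviation_no_rise_and_fall[OF bal nm rise that] rise by simp
  qed
  show "\<not> recurrent_word d"
  proof
    assume "recurrent_word d"
    hence "infinite {j. word_factor d j (m - n) = word_factor d n (m - n)}"
      by (simp add: recurrent_word_def)
    then obtain j where j: "j \<ge> m" "word_factor d j (m - n) = word_factor d n (m - n)"
      unfolding infinite_nat_iff_unbounded_le by auto
    have "deviation d \<alpha> (j + (m - n)) - deviation d \<alpha> j
        = deviation d \<alpha> (n + (m - n)) - deviation d \<alpha> n"
      unfolding deviation_diff using bsum_word_factor_cong[OF j(2)] by simp
    thus False using gt[OF j(1)] le[of "j + (m - n)"] rise nm by simp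
  qed
qed

text \<open>Relative to position \<open>m\<close>, where the deviation is maximal, all later
  deviations lie in (-1, 0].\<close>

lemma rise_eventually_mechanical:
  assumes bal: "sum_balanced d" and sl: "has_slope d \<alpha>"
    and nm: "n \<le> m" and rise: "deviation d \<alpha> m = deviation d \<alpha> n + 1"
  shows "bsum d m k = \<lfloor>real k * \<alpha>\<rfloor>"
  using rise_not_recurrent(2)[OF assms, of "m + k"] rise_not_recurrent(3)[OF assms, of "m + k"]
    deviation_diff[of d \<alpha> m k] rise
  by (intro floor_unique[symmetric]) (simp_all add: algebra_simps)

lemma word_factor_uminus:
  fixes d :: "nat \<Rightarrow> int"
  shows "word_factor (\<lambda>n. - d n) i m = map uminus (word_factor d i m)"
  by (simp add: word_factor_def)

lemma recurrent_word_uminus: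
  fixes d :: "nat \<Rightarrow> int"
  assumes "recurrent_word d"
  shows "recurrent_word (\<lambda>n. - d n)"
proof -
  have "inj (map (uminus :: int \<Rightarrow> int))" by (simp add: inj_mapI inj_on_def)
  thus ?thesis using assms by (simp add: recurrent_word_def word_factor_uminus inj_eq)
qed

text \<open>If two deviations differ by exactly 1, the distance of their positions times
  \<open>\<alpha>\<close> is an integer, so \<open>\<alpha>\<close> is rational. A rise leaves a
  lower mechanical tail of intercept 0, a fall an upper one.\<close>

lemma mechanical_or_skew:
  assumes bal: "sum_balanced d" and sl: "has_slope d \<alpha>" and nn: "0 \<le> \<alpha>"
  shows "mechanical_word \<alpha> d \<or>
    (\<alpha> \<in> \<rat> \<and> \<not> recurrent_word d \<and> (\<exists>k\<ge>1. mechanical_word \<alpha> (\<lambda>n. d (n + k))))"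
proof (cases "\<exists>n m. deviation d \<alpha> m = deviation d \<alpha> n + 1")
  case False
  thus ?thesis using mechanical_wordI[OF sl nn] by metis
next
  case True
  then obtain n m where nm: "deviation d \<alpha> m = deviation d \<alpha> n + 1" by blast
  have neq: "n \<noteq> m" using nm by auto
  have "real_of_int (bsum d 0 m - bsum d 0 n - 1) = (real m - real n) * \<alpha>"
    using nm by (simp add: deviation_def algebra_simps)
  hence "\<alpha> = real_of_int (bsum d 0 m - bsum d 0 n - 1) / (real m - real n)"
    using neq by (simp add: field_simps)
  hence rat: "\<alpha> \<in> \<rat>" by simp
  show ?thesis
  proof (cases "n \<le> m")
    case le: True
    have "bsum (\<lambda>n. d (n + m)) 0 k = \<lfloor>\<alpha> * real k + 0\<rfloor>" for k
      using rise_eventually_mechanical[OF bal sl le nm] by (simp add: bsum_shift mult.commute)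
    from lower_mechanicalI[OF this] have "mechanical_word \<alpha> (\<lambda>n. d (n + m))"
      using nn unfolding mechanical_word_def by (intro conjI bexI[of _ 0]) simp_all
    moreover have "m \<ge> 1" using le neq by simp
    ultimately show ?thesis using rat rise_not_recurrent(1)[OF bal sl le nm] by blast
  next
    case False
    hence le: "m \<le> n" by simp
    \<comment> \<open>A fall of \<open>d\<close> is a rise of the negated word.\<close>
    have nm': "deviation (\<lambda>n. - d n) (- \<alpha>) n = deviation (\<lambda>n. - d n) (- \<alpha>) m + 1"
      using nm by (simp add: deviation_uminus)
    note asm = sum_balanced_uminus[OF bal] has_slope_uminus[OF sl] le nm'
    have "bsum (\<lambda>k. d (k + n)) 0 k = \<lceil>\<alpha> * real k + 0\<rceil> - 0" for k
      using rise_eventually_mechanical[OF asm, of k]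
      by (simp add: bsum_shift bsum_uminus mult.commute ceiling_def)
    from upper_mechanicalI[OF this] have "mechanical_word \<alpha> (\<lambda>k. d (k + n))"
      using nn unfolding mechanical_word_def by (intro conjI bexI[of _ 0]) simp_all
    moreover have "n \<ge> 1" using False by simp
    moreover have "\<not> recurrent_word d"
      using rise_not_recurrent(1)[OF asm] recurrent_word_uminus by blast
    ultimately show ?thesis using rat by blast
  qed
qed

text \<open>After subtracting \<open>a\<close> from each letter, a block sum counts the letter
  \<open>a + 1\<close>; this turns balance of sums into balance of letter counts.\<close>

lemma count_word_factor:
  assumes "range d \<subseteq> {a, a + 1}"
  shows "int (count_list (word_factor d i m) c) =
    (if c = a + 1 then bsum d i m - int m * a
     else if c = a then int m * (a + 1) - bsum d i m else 0)"
proof (induction m)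
  case (Suc m)
  have "d (i + m) = a \<or> d (i + m) = a + 1" using assms by auto
  moreover have "word_factor d i (Suc m) = word_factor d i m @ [d (i + m)]"
    by (simp add: word_factor_def)
  ultimately show ?case using Suc by (auto simp: bsum_Suc algebra_simps)
qed (simp add: word_factor_def)

lemma sum_balanced_imp_balanced_word:
  assumes "range d \<subseteq> {a, a + 1}" "sum_balanced d"
  shows "balanced_word d"
  unfolding balanced_word_def count_word_factor[OF assms(1)]
proof (intro allI)
  fix m i j c
  show "\<bar>(if c = a + 1 then bsum d i m - int m * a
         else if c = a then int m * (a + 1) - bsum d i m else 0) -
        (if c = a + 1 then bsum d j m - int m * a
         else if c = a then int m * (a + 1) - bsum d j m else 0)\<bar> \<le> 1"
    using assms(2) unfolding sum_balanced_def by (auto simp: abs_minus_commute)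
qed

section \<open>Monotone series in the digit sums\<close>

text \<open>If \<open>s\<close> lists the partial sums of a digit sequence, starting with
  \<open>s 0 = 0\<close>, Abel summation makes this the number with these digits in base
  \<open>\<beta>\<close>; hence the factor in front.\<close>

definition phi :: "real \<Rightarrow> (nat \<Rightarrow> real) \<Rightarrow> real" where
  "phi \<beta> s = (1 - 1 / \<beta>) * (\<Sum>k. s k / \<beta> ^ k)"

text \<open>The constant \<open>M\<close> is explicit because \<open>phi_approx\<close> has to bound
  the tails of all sequences with the same \<open>M\<close> at once.\<close>

definition linear_growth :: "real \<Rightarrow> (nat \<Rightarrow> real) \<Rightarrow> bool" where
  "linear_growth M s \<longleftrightarrow> (\<forall>k. \<bar>s k\<bar> \<le> M * (real k + 1))"

lemma linear_growth_mono: "linear_growth M s \<Longrightarrow> M \<le> N \<Longrightarrow> linear_growth N s"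
  unfolding linear_growth_def
proof
  fix k
  assume *: "\<forall>k. \<bar>s k\<bar> \<le> M * (real k + 1)" "M \<le> N"
  have "\<bar>s k\<bar> \<le> M * (real k + 1)" using * by simp
  also have "\<dots> \<le> N * (real k + 1)" using * by (intro mult_right_mono) auto
  finally show "\<bar>s k\<bar> \<le> N * (real k + 1)" .
qed

lemma linear_growth_diff:
  assumes "linear_growth M s" "linear_growth N t"
  shows "linear_growth (M + N) (\<lambda>k. s k - t k)"
  unfolding linear_growth_def
proof
  fix k
  have "\<bar>s k - t k\<bar> \<le> \<bar>s k\<bar> + \<bar>t k\<bar>" by simp
  also have "\<dots> \<le> M * (real k + 1) + N * (real k + 1)"
    using assms by (intro add_mono) (auto simp: linear_growth_def)
  finally show "\<bar>s k - t k\<bar> \<le> (M + N) * (real k + 1)" by (simp add: algebra_simps)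
qed

lemma linear_growth_floor: "linear_growth (\<bar>\<alpha>\<bar> + 1) (\<lambda>k. real_of_int \<lfloor>real k * \<alpha>\<rfloor>)"
  unfolding linear_growth_def
proof
  fix k
  have "\<bar>real_of_int \<lfloor>real k * \<alpha>\<rfloor>\<bar> \<le> \<bar>real k * \<alpha>\<bar> + 1" by linarith
  also have "\<dots> \<le> (\<bar>\<alpha>\<bar> + 1) * (real k + 1)" by (simp add: abs_mult algebra_simps)
  finally show "\<bar>real_of_int \<lfloor>real k * \<alpha>\<rfloor>\<bar> \<le> (\<bar>\<alpha>\<bar> + 1) * (real k + 1)" .
qed

lemma linear_growth_ceiling: "linear_growth (\<bar>\<alpha>\<bar> + 1) (\<lambda>k. real_of_int \<lceil>real k * \<alpha>\<rceil>)"
  using linear_growth_floor[of "- \<alpha>"] by (simp add: linear_growth_def ceiling_def)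

lemma linear_growth_slope:
  assumes "has_slope d \<alpha>"
  shows "linear_growth (\<bar>\<alpha>\<bar> + 1) (\<lambda>k. real_of_int (bsum d n k))"
  unfolding linear_growth_def
proof
  fix k
  have "\<bar>real_of_int (bsum d n k)\<bar> \<le> \<bar>real k * \<alpha>\<bar> + 1"
    using assms[unfolded has_slope_def, rule_format, of n k] by linarith
  also have "\<dots> \<le> (\<bar>\<alpha>\<bar> + 1) * (real k + 1)" by (simp add: abs_mult algebra_simps)
  finally show "\<bar>real_of_int (bsum d n k)\<bar> \<le> (\<bar>\<alpha>\<bar> + 1) * (real k + 1)" .
qed

lemma linear_growth_positive: "linear_growth 1 (\<lambda>k. if k = 0 then 0 else 1)"
  by (simp add: linear_growth_def)

locale base =
  fixes \<beta> :: real
  assumes base_gt_1: "1 < \<beta>"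
begin

lemma summable_linear: "summable (\<lambda>k. M * (real k + 1) / \<beta> ^ k)"
proof -
  have "summable (\<lambda>k. of_nat (Suc k) * (1 / \<beta>) ^ k)"
    using geometric_deriv_sums[of "1 / \<beta>"] base_gt_1 by (auto simp: sums_iff)
  hence "summable (\<lambda>k. M * (of_nat (Suc k) * (1 / \<beta>) ^ k))" by (rule summable_mult)
  moreover have "(\<lambda>k. M * (of_nat (Suc k) * (1 / \<beta>) ^ k)) = (\<lambda>k. M * (real k + 1) / \<beta> ^ k)"
    by (simp add: fun_eq_iff power_one_over field_simps)
  ultimately show ?thesis by argo
qed

lemma linear_growth_summable:
  assumes "linear_growth M s"
  shows "summable (\<lambda>k. s k / \<beta> ^ k)"
proof (rule summable_comparison_test'[OF summable_linear[of M], of 0])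
  fix k
  have "\<bar>s k\<bar> / \<beta> ^ k \<le> M * (real k + 1) / \<beta> ^ k"
    using assms base_gt_1 by (intro divide_right_mono) (auto simp: linear_growth_def)
  thus "norm (s k / \<beta> ^ k) \<le> M * (real k + 1) / \<beta> ^ k" using base_gt_1 by simp
qed

lemma scale_pos: "0 < 1 - 1 / \<beta>"
  using base_gt_1 by simp

lemma phi_mono:
  assumes "linear_growth M s" "linear_growth N t" "\<And>k. s k \<le> t k"
  shows "phi \<beta> s \<le> phi \<beta> t"
proof -
  have "(\<Sum>k. s k / \<beta> ^ k) \<le> (\<Sum>k. t k / \<beta> ^ k)"
    using assms base_gt_1
    by (intro suminf_le linear_growth_summable) (auto intro!: divide_right_mono)
  thus ?thesis unfolding phi_def using scale_pos by (intro mult_left_mono) auto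
qed

lemma phi_diff:
  assumes "linear_growth M s" "linear_growth N t"
  shows "phi \<beta> (\<lambda>k. s k - t k) = phi \<beta> s - phi \<beta> t"
proof -
  have "(\<Sum>k. (s k - t k) / \<beta> ^ k) = (\<Sum>k. s k / \<beta> ^ k) - (\<Sum>k. t k / \<beta> ^ k)"
    using suminf_diff[OF linear_growth_summable[OF assms(1)] linear_growth_summable[OF assms(2)]]
    by (simp add: diff_divide_distrib)
  thus ?thesis by (simp add: phi_def right_diff_distrib)
qed

lemma phi_strict_mono:
  assumes "linear_growth M s" "linear_growth N t" "\<And>k. s k \<le> t k" "s j < t j"
  shows "phi \<beta> s < phi \<beta> t"
proof -
  have g: "linear_growth (N + M) (\<lambda>k. t k - s k)" by (rule linear_growth_diff) fact+
  have "0 < (\<Sum>k. (t k - s k) / \<beta> ^ k)"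
    by (rule suminf_pos2[where i = j]) (use linear_growth_summable[OF g] assms base_gt_1 in auto)
  hence "0 < phi \<beta> (\<lambda>k. t k - s k)" unfolding phi_def using scale_pos by simp
  thus ?thesis using phi_diff[OF assms(2,1)] by simp
qed

text \<open>Up to an error \<open>e\<close> only the first \<open>K\<close> terms matter, with one
  \<open>K\<close> for all sequences of growth \<open>M\<close>. Limits of slopes and of orbit
  points thus reduce to finitely many digit sums.\<close>

lemma phi_approx:
  assumes "0 < e"
  obtains K where "\<And>s t. linear_growth M s \<Longrightarrow> linear_growth M t \<Longrightarrow>
    (\<And>k. k < K \<Longrightarrow> s k \<le> t k) \<Longrightarrow> phi \<beta> s \<le> phi \<beta> t + e"
proof -
  \<comment> \<open>The factor 2 is due to the difference of two sequences of growth
    \<open>M\<close>.\<close>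
  obtain K where K: "norm (\<Sum>k. (2 * M) * (real (k + K) + 1) / \<beta> ^ (k + K)) < e"
    using suminf_exist_split[OF assms summable_linear[of "2 * M"]] by auto
  have "phi \<beta> s \<le> phi \<beta> t + e"
    if s: "linear_growth M s" and t: "linear_growth M t" and le: "\<And>k. k < K \<Longrightarrow> s k \<le> t k" for s t
  proof -
    define h where "h = (\<lambda>k. s k - t k)"
    have h: "linear_growth (2 * M) h" using linear_growth_diff[OF s t] by (simp add: h_def)
    have sm: "summable (\<lambda>k. h k / \<beta> ^ k)" by (rule linear_growth_summable[OF h])
    have "(\<Sum>k. h k / \<beta> ^ k) = (\<Sum>k. h (k + K) / \<beta> ^ (k + K)) + (\<Sum>k<K. h k / \<beta> ^ k)"
      by (rule suminf_split_initial_segment[OF sm])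
    also have "(\<Sum>k<K. h k / \<beta> ^ k) \<le> 0"
      using le base_gt_1 by (intro sum_nonpos) (auto simp: h_def divide_nonpos_pos)
    also have "(\<Sum>k. h (k + K) / \<beta> ^ (k + K)) \<le> (\<Sum>k. (2 * M) * (real (k + K) + 1) / \<beta> ^ (k + K))"
    proof (intro suminf_le)
      show "h (k + K) / \<beta> ^ (k + K) \<le> 2 * M * (real (k + K) + 1) / \<beta> ^ (k + K)" for k
      proof (rule divide_right_mono)
        show "h (k + K) \<le> 2 * M * (real (k + K) + 1)"
          using h[unfolded linear_growth_def, rule_format, of "k + K"] by linarith
      qed (use base_gt_1 in simp)
    qed (use summable_ignore_initial_segment[OF sm, of K]
          summable_ignore_initial_segment[OF summable_linear[of "2 * M"], of K] in simp_all)
    also have "\<dots> \<le> e" using K by simp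
    finally have "(\<Sum>k. h k / \<beta> ^ k) \<le> e" by simp
    hence "phi \<beta> h \<le> (1 - 1 / \<beta>) * e"
      unfolding phi_def using scale_pos by (intro mult_left_mono) auto
    also have "\<dots> \<le> e" using assms base_gt_1 by (simp add: field_simps)
    finally show ?thesis using phi_diff[OF s t] by (simp add: h_def)
  qed
  thus ?thesis using that by blast
qed

text \<open>For partial digit sums \<open>s 1\<close> is the first digit, and this is the effect of
  one step of the expansion.\<close>

lemma phi_shift:
  assumes "linear_growth M s" "s 0 = 0"
  shows "phi \<beta> (\<lambda>k. s (Suc k) - s 1) = \<beta> * phi \<beta> s - s 1"
proof -
  have sm: "summable (\<lambda>k. s k / \<beta> ^ k)" by (rule linear_growth_summable) fact
  have "(\<lambda>k. s (Suc k) / \<beta> ^ Suc k) sums ((\<Sum>k. s k / \<beta> ^ k) - s 0 / \<beta> ^ 0)"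
    using summable_sums[OF sm] by (subst sums_Suc_iff) auto
  hence "(\<lambda>k. \<beta> * (s (Suc k) / \<beta> ^ Suc k)) sums (\<beta> * (\<Sum>k. s k / \<beta> ^ k))"
    using assms(2) by (intro sums_mult) simp
  hence 1: "(\<lambda>k. s (Suc k) / \<beta> ^ k) sums (\<beta> * (\<Sum>k. s k / \<beta> ^ k))"
    using base_gt_1 by simp
  have "(\<lambda>k. s 1 * (1 / \<beta>) ^ k) sums (s 1 * (1 / (1 - 1 / \<beta>)))"
    using base_gt_1 by (intro sums_mult geometric_sums) simp
  hence 2: "(\<lambda>k. s 1 / \<beta> ^ k) sums (s 1 / (1 - 1 / \<beta>))"
    by (simp add: power_one_over)
  have "(\<lambda>k. (s (Suc k) - s 1) / \<beta> ^ k) sums (\<beta> * (\<Sum>k. s k / \<beta> ^ k) - s 1 / (1 - 1 / \<beta>))"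
    using sums_diff[OF 1 2] by (simp add: diff_divide_distrib)
  hence "(\<Sum>k. (s (Suc k) - s 1) / \<beta> ^ k) = \<beta> * (\<Sum>k. s k / \<beta> ^ k) - s 1 / (1 - 1 / \<beta>)"
    by (simp add: sums_iff)
  thus ?thesis unfolding phi_def using base_gt_1 by (simp add: right_diff_distrib)
qed

text \<open>The series over all \<open>k\<close> minus the series over the multiples of
  \<open>q\<close>; both are geometric.\<close>

lemma phi_dvd:
  assumes "q \<ge> 1"
  shows "phi \<beta> (\<lambda>k. if q dvd k then 0 else 1) = (\<beta> ^ (q - 1) - 1) / (\<beta> ^ q - 1)"
proof -
  have b: "\<beta> ^ q > 1" using base_gt_1 assms by (simp add: one_less_power)
  have 1: "(\<lambda>k. (1 / \<beta>) ^ k) sums (1 / (1 - 1 / \<beta>))"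
    using base_gt_1 by (intro geometric_sums) simp
  have "(\<lambda>k. (1 / \<beta> ^ q) ^ k) sums (1 / (1 - 1 / \<beta> ^ q))"
    using b by (intro geometric_sums) simp
  moreover have "(\<lambda>k. (1 / \<beta> ^ q) ^ k) = (\<lambda>k. if q dvd q * k then (1 / \<beta>) ^ (q * k) else 0)"
    by (simp add: power_mult power_one_over)
  ultimately have "(\<lambda>k. if q dvd q * k then (1 / \<beta>) ^ (q * k) else 0) sums (1 / (1 - 1 / \<beta> ^ q))"
    by simp
  hence 2: "(\<lambda>k. if q dvd k then (1 / \<beta>) ^ k else 0) sums (1 / (1 - 1 / \<beta> ^ q))"
    using assms by (subst (asm) sums_mono_reindex) (auto simp: strict_mono_def)
  have "(\<lambda>k. (1 / \<beta>) ^ k - (if q dvd k then (1 / \<beta>) ^ k else 0))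
      = (\<lambda>k. (if q dvd k then 0 else 1) / \<beta> ^ k)"
    by (auto simp: power_one_over)
  with sums_diff[OF 1 2] have "(\<Sum>k. (if q dvd k then 0 else 1) / \<beta> ^ k)
      = 1 / (1 - 1 / \<beta>) - 1 / (1 - 1 / \<beta> ^ q)"
    by (simp add: sums_iff)
  hence "phi \<beta> (\<lambda>k. if q dvd k then 0 else 1) = 1 - (1 - 1 / \<beta>) / (1 - 1 / \<beta> ^ q)"
    unfolding phi_def using base_gt_1 by (simp add: right_diff_distrib)
  also have "\<dots> = (\<beta> ^ q / \<beta> - 1) / (\<beta> ^ q - 1)"
    using b base_gt_1 by (simp add: field_simps)
  also have "\<beta> ^ q / \<beta> = \<beta> ^ (q - 1)"
    using assms base_gt_1 by (simp add: power_diff)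
  finally show ?thesis .
qed

lemma phi_positive: "phi \<beta> (\<lambda>k. if k = 0 then 0 else 1) = 1 / \<beta>"
proof -
  have "(\<lambda>k. (1 / \<beta>) ^ Suc k) sums (1 / \<beta> * (1 / (1 - 1 / \<beta>)))"
    unfolding power_Suc using base_gt_1 by (intro sums_mult geometric_sums) simp
  hence "(\<lambda>k. (if Suc k = 0 then 0 else 1) / \<beta> ^ Suc k) sums (1 / \<beta> * (1 / (1 - 1 / \<beta>)))"
    by (simp add: power_one_over)
  hence "(\<lambda>k. (if k = 0 then 0 else 1) / \<beta> ^ k) sums (1 / \<beta> * (1 / (1 - 1 / \<beta>)))"
    by (subst (asm) sums_Suc_iff) simp
  thus ?thesis unfolding phi_def using base_gt_1 by (simp add: sums_iff)
qed

section \<open>The two extremal values of a slope\<close>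

definition slope_sup :: "real \<Rightarrow> real" where
  "slope_sup \<alpha> = phi \<beta> (\<lambda>k. real_of_int \<lceil>real k * \<alpha>\<rceil>)"

text \<open>\<open>slope_sup\<close> and \<open>slope_inf\<close> are the values of
  \<open>phi\<close> at the digit sums of the upper and the lower mechanical word with intercept
  0.\<close>

definition slope_inf :: "real \<Rightarrow> real" where
  "slope_inf \<alpha> = phi \<beta> (\<lambda>k. real_of_int \<lfloor>real k * \<alpha>\<rfloor>)"

text \<open>The width depends only on which multiples of \<open>\<alpha>\<close> are integers: just
  \<open>k = 0\<close> for irrational \<open>\<alpha>\<close>, the multiples of \<open>q\<close> for
  a reduced fraction with denominator \<open>q\<close>.\<close>

lemma slope_sup_diff_inf:
  "slope_sup \<alpha> - slope_inf \<alpha> = phi \<beta> (\<lambda>k. if real k * \<alpha> \<in> \<int> then 0 else 1)"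
proof -
  have "(\<lambda>k. real_of_int \<lceil>real k * \<alpha>\<rceil> - real_of_int \<lfloor>real k * \<alpha>\<rfloor>)
      = (\<lambda>k. if real k * \<alpha> \<in> \<int> then 0 else 1)"
  proof
    fix k
    show "real_of_int \<lceil>real k * \<alpha>\<rceil> - real_of_int \<lfloor>real k * \<alpha>\<rfloor>
        = (if real k * \<alpha> \<in> \<int> then 0 else 1)"
      using ceiling_altdef[of "real k * \<alpha>"] by (cases "real k * \<alpha> \<in> \<int>") (auto elim: Ints_cases simp: Ints_def)
  qed
  thus ?thesis unfolding slope_sup_def slope_inf_def
    using phi_diff[OF linear_growth_ceiling[of \<alpha>] linear_growth_floor[of \<alpha>]] by simp
qed

lemma slope_width_irrational:
  assumes "\<alpha> \<notin> \<rat>"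
  shows "slope_sup \<alpha> - slope_inf \<alpha> = 1 / \<beta>"
proof -
  have "real k * \<alpha> \<in> \<int> \<longleftrightarrow> k = 0" for k
  proof
    assume "real k * \<alpha> \<in> \<int>"
    show "k = 0"
    proof (rule ccontr)
      assume "k \<noteq> 0"
      hence "\<alpha> = real k * \<alpha> / real k" by simp
      also have "\<dots> \<in> \<rat>" using \<open>real k * \<alpha> \<in> \<int>\<close> Ints_subset_Rats by (intro Rats_divide) auto
      finally show False using assms by simp
    qed
  qed simp
  thus ?thesis by (simp add: slope_sup_diff_inf phi_positive)
qed

lemma slope_width_rational:
  assumes "q \<ge> 1" "coprime p (int q)"
  shows "slope_sup (real_of_int p / real q) - slope_inf (real_of_int p / real q)
    = (\<beta> ^ (q - 1) - 1) / (\<beta> ^ q - 1)"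
proof -
  have "real k * (real_of_int p / real q) \<in> \<int> \<longleftrightarrow> q dvd k" for k
  proof
    assume "real k * (real_of_int p / real q) \<in> \<int>"
    then obtain z where "real k * (real_of_int p / real q) = real_of_int z" by (auto elim: Ints_cases)
    hence "real_of_int (int k * p) = real_of_int (z * int q)" using assms(1) by (simp add: field_simps)
    hence "int k * p = z * int q" by (simp only: of_int_eq_iff)
    hence "int q dvd int k * p" by simp
    thus "q dvd k" using assms(2) by (simp add: coprime_commute coprime_dvd_mult_left_iff)
  next
    assume "q dvd k"
    then obtain j where "k = q * j" ..
    hence "real k * (real_of_int p / real q) = real_of_int (int j * p)" using assms(1) by simp
    thus "real k * (real_of_int p / real q) \<in> \<int>" by (simp only: Ints_of_int)
  qed
  thus ?thesis by (simp add: slope_sup_diff_inf phi_dvd[OF assms(1)])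
qed

end

section \<open>Orbits and digit sums\<close>

lemma finite_lower_bound:
  fixes f :: "nat \<Rightarrow> real"
  assumes "\<And>k. k < K \<Longrightarrow> 0 < f k"
  obtains \<epsilon> where "0 < \<epsilon>" "\<And>k. k < K \<Longrightarrow> \<epsilon> < f k"
proof -
  have "\<exists>\<epsilon>>0. \<forall>k<K. \<epsilon> < f k"
    using assms
  proof (induction K)
    case (Suc K)
    then obtain \<epsilon> where \<epsilon>: "\<epsilon> > 0" "\<forall>k<K. \<epsilon> < f k" by auto
    have "f K > 0" using Suc.prems by simp
    thus ?case using \<epsilon> by (intro exI[of _ "min \<epsilon> (f K / 2)"]) (auto simp: less_Suc_eq min_less_iff_disj)
  qed (auto intro: exI[of _ 1])
  thus ?thesis using that by blast
qed

text \<open>Provides a change of slope that moves the first \<open>K\<close> multiples by at most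
  \<open>\<epsilon>\<close>; \<open>\<delta> \<le> 1\<close> keeps the growth constants under
  control.\<close>

lemma small_multiples:
  fixes \<epsilon> :: real
  assumes "0 < \<epsilon>"
  obtains \<delta> where "0 < \<delta>" "\<delta> \<le> 1" "\<And>k. k < K \<Longrightarrow> real k * \<delta> \<le> \<epsilon>"
proof -
  define \<delta> where "\<delta> = min 1 (\<epsilon> / (real K + 1))"
  have d: "0 < \<delta>" "\<delta> \<le> 1" "\<delta> \<le> \<epsilon> / (real K + 1)" using assms by (auto simp: \<delta>_def)
  have "real k * \<delta> \<le> \<epsilon>" if "k < K" for k
  proof -
    have "real k * \<delta> \<le> (real K + 1) * (\<epsilon> / (real K + 1))"
      using d that by (intro mult_mono) auto
    thus ?thesis by simp
  qed
  thus ?thesis using that d by blast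
qed

context base
begin

lemma phi_uminus:
  assumes "linear_growth M s"
  shows "phi \<beta> (\<lambda>k. - s k) = - phi \<beta> s"
  using suminf_minus[OF linear_growth_summable[OF assms]] by (simp add: phi_def)

text \<open>The ceiling covers both cases of \<open>upper_frac\<close>: at an integer it exceeds the
  subtracted digit by 1, which gives the value 1.\<close>

lemma Tbar_eq: "Tbar \<beta> x = \<beta> * x - real_of_int (\<lceil>\<beta> * x\<rceil> - 1)"
proof (cases "\<beta> * x \<in> \<int>")
  case True
  thus ?thesis by (auto simp: Tbar_def upper_frac_def elim!: Ints_cases)
next
  case False
  hence "\<beta> * x \<noteq> real_of_int \<lfloor>\<beta> * x\<rfloor>" by (metis Ints_of_int)
  thus ?thesis using False by (simp add: Tbar_def upper_frac_def frac_def ceiling_altdef)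
qed

lemma Tbar_bounds: "0 < Tbar \<beta> x" "Tbar \<beta> x \<le> 1"
  unfolding Tbar_eq by linarith+

lemma orbit_Suc: "(Tbar \<beta> ^^ Suc n) x = \<beta> * (Tbar \<beta> ^^ n) x - real_of_int (dbar \<beta> x n)"
  by (simp add: Tbar_eq dbar_def)

lemma orbit_add: "(Tbar \<beta> ^^ n) ((Tbar \<beta> ^^ i) x) = (Tbar \<beta> ^^ (n + i)) x"
  by (simp add: funpow_add)

lemma dbar_shift: "dbar \<beta> ((Tbar \<beta> ^^ i) x) = (\<lambda>n. dbar \<beta> x (n + i))"
  by (simp add: dbar_def orbit_add fun_eq_iff)

lemma orbit_unit: "x \<in> {0..1} \<Longrightarrow> (Tbar \<beta> ^^ n) x \<in> {0..1}"
  using Tbar_bounds by (cases n) (auto intro: less_imp_le)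

lemma orbit_pos: "0 < x \<Longrightarrow> 0 < (Tbar \<beta> ^^ n) x"
  using Tbar_bounds by (cases n) auto

lemma dbar_nonneg: "0 < x \<Longrightarrow> 0 \<le> dbar \<beta> x n"
proof -
  assume "0 < x"
  hence "0 < \<beta> * (Tbar \<beta> ^^ n) x" using orbit_pos base_gt_1 by simp
  thus ?thesis unfolding dbar_def by linarith
qed

lemma dbar_le:
  assumes "x \<in> {0..1}"
  shows "\<bar>real_of_int (dbar \<beta> x n)\<bar> \<le> \<beta>" "dbar \<beta> x n \<le> \<lceil>\<beta>\<rceil> - 1"
proof -
  have "0 \<le> \<beta> * (Tbar \<beta> ^^ n) x" "\<beta> * (Tbar \<beta> ^^ n) x \<le> \<beta> * 1"
    using orbit_unit[OF assms, of n] base_gt_1 by (auto intro!: mult_left_mono simp del: mult_1_right)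
  thus "\<bar>real_of_int (dbar \<beta> x n)\<bar> \<le> \<beta>" "dbar \<beta> x n \<le> \<lceil>\<beta>\<rceil> - 1"
    unfolding dbar_def using base_gt_1 by (linarith, intro diff_right_mono ceiling_mono) simp
qed

lemma linear_growth_dbar:
  assumes "x \<in> {0..1}"
  shows "linear_growth \<beta> (\<lambda>k. real_of_int (bsum (dbar \<beta> x) n k))"
  unfolding linear_growth_def
proof
  fix k
  have "\<bar>real_of_int (bsum (dbar \<beta> x) n k)\<bar> \<le> (\<Sum>j<k. \<bar>real_of_int (dbar \<beta> x (n + j))\<bar>)"
    by (simp add: bsum_def)
  also have "\<dots> \<le> real k * \<beta>"
    using sum_bounded_above[of "{..<k}" "\<lambda>j. \<bar>real_of_int (dbar \<beta> x (n + j))\<bar>" \<beta>] dbar_le(1)[OF assms]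
    by simp
  also have "\<dots> \<le> \<beta> * (real k + 1)" using base_gt_1 by (simp add: algebra_simps)
  finally show "\<bar>real_of_int (bsum (dbar \<beta> x) n k)\<bar> \<le> \<beta> * (real k + 1)" .
qed

text \<open>Abel summation of the expansion \<open>x = \<Sum> d\<^sub>k \<beta>\<^bsup>-k-1\<^esup>\<close>: this makes \<open>x\<close> a monotone function of
  the partial digit sums.\<close>

lemma orbit_start_eq_phi:
  assumes "x \<in> {0..1}"
  shows "x = phi \<beta> (\<lambda>k. real_of_int (bsum (dbar \<beta> x) 0 k))"
proof -
  define s where "s = (\<lambda>k. real_of_int (bsum (dbar \<beta> x) 0 k))"
  define y where "y = (\<lambda>k. (Tbar \<beta> ^^ k) x)"
  have part: "(\<Sum>k<n. (1 - 1 / \<beta>) * (s k / \<beta> ^ k)) = x - y n / \<beta> ^ n - s n / \<beta> ^ n" for n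
  proof (induction n)
    case (Suc n)
    have s_Suc: "s (Suc n) = s n + (\<beta> * y n - y (Suc n))"
      using orbit_Suc[of n x] by (simp add: s_def y_def bsum_Suc)
    have "(1 - 1 / \<beta>) * (s n / \<beta> ^ n) = y n / \<beta> ^ n + s n / \<beta> ^ n
        - y (Suc n) / \<beta> ^ Suc n - s (Suc n) / \<beta> ^ Suc n"
      using base_gt_1 by (simp add: s_Suc field_simps)
    thus ?case using Suc by simp
  qed (simp add: s_def y_def)
  have gs: "summable (\<lambda>k. s k / \<beta> ^ k)"
    unfolding s_def by (rule linear_growth_summable[OF linear_growth_dbar[OF assms]])
  have "linear_growth 1 y"
    unfolding linear_growth_def using orbit_unit[OF assms] by (auto simp: y_def intro: add_increasing)
  hence "summable (\<lambda>k. y k / \<beta> ^ k)" by (rule linear_growth_summable)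
  hence "(\<lambda>n. x - y n / \<beta> ^ n - s n / \<beta> ^ n) \<longlonglongrightarrow> x - 0 - 0"
    using gs by (intro tendsto_diff tendsto_const summable_LIMSEQ_zero)
  hence "(\<lambda>k. (1 - 1 / \<beta>) * (s k / \<beta> ^ k)) sums x" unfolding sums_def part by simp
  moreover have "(\<lambda>k. (1 - 1 / \<beta>) * (s k / \<beta> ^ k)) sums phi \<beta> s"
    unfolding phi_def by (intro sums_mult summable_sums gs)
  ultimately show ?thesis using sums_unique2 by (auto simp: s_def)
qed

lemma orbit_eq_phi:
  assumes "x \<in> {0..1}"
  shows "(Tbar \<beta> ^^ n) x = phi \<beta> (\<lambda>k. real_of_int (bsum (dbar \<beta> x) n k))"
  using orbit_start_eq_phi[OF orbit_unit[OF assms], of n] by (simp add: dbar_shift bsum_shift)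

text \<open>That the next value lies in (0, 1] determines the digit as
  \<open>\<lceil>\<beta> * y n\<rceil> - 1\<close>. This realizes a prescribed word as an
  expansion.\<close>

lemma orbit_of_recurrence:
  assumes "\<And>n. 0 < y n" "\<And>n. y n \<le> 1" "\<And>n. y (Suc n) = \<beta> * y n - real_of_int (d n)"
  shows "(Tbar \<beta> ^^ n) (y 0) = y n" "dbar \<beta> (y 0) n = d n"
proof -
  have c: "\<lceil>\<beta> * y n\<rceil> = d n + 1" for n
    using assms(1,2)[of "Suc n"] assms(3)[of n] by (intro ceiling_unique) auto
  show o: "(Tbar \<beta> ^^ n) (y 0) = y n" for n
    by (induction n) (simp_all add: Tbar_eq c assms(3))
  show "dbar \<beta> (y 0) n = d n" by (simp add: dbar_def o c)
qed

section \<open>Small diameter forces balanced digits\<close>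

lemma Diam_imp_close:
  assumes "x \<in> {0..1}" "Diam \<beta> x \<le> c"
  shows "(Tbar \<beta> ^^ i) x - (Tbar \<beta> ^^ j) x \<le> c"
proof -
  have "(Tbar \<beta> ^^ i) x \<le> (SUP n. (Tbar \<beta> ^^ n) x)"
    using orbit_unit[OF assms(1)] by (intro cSUP_upper bdd_aboveI[of _ 1]) auto
  moreover have "(INF n. (Tbar \<beta> ^^ n) x) \<le> (Tbar \<beta> ^^ j) x"
    using orbit_unit[OF assms(1)] by (intro cINF_lower bdd_belowI[of _ 0]) auto
  ultimately show ?thesis using assms(2) by (simp add: Diam_def)
qed

lemma close_imp_dbar_le:
  assumes "(Tbar \<beta> ^^ i) x - (Tbar \<beta> ^^ j) x \<le> 1 / \<beta>"
  shows "dbar \<beta> x i \<le> dbar \<beta> x j + 1"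
proof -
  have "\<beta> * (Tbar \<beta> ^^ i) x \<le> \<beta> * (Tbar \<beta> ^^ j) x + 1"
    using assms base_gt_1 by (simp add: field_simps)
  thus ?thesis unfolding dbar_def by linarith
qed

text \<open>In a shortest pair of blocks violating balance, the first and the last digits differ and the
  inner parts agree. The first digits reverse the order of the orbit points, the inner digits keep
  it, and the last digits then contradict it.\<close>

lemma close_imp_sum_balanced:
  assumes close: "\<And>i j. (Tbar \<beta> ^^ i) x - (Tbar \<beta> ^^ j) x \<le> 1 / \<beta>"
  shows "sum_balanced (dbar \<beta> x)"
proof (rule ccontr)
  define d where "d = dbar \<beta> x"
  define y where "y = (\<lambda>n. (Tbar \<beta> ^^ n) x)"
  have step: "y (Suc n) = \<beta> * y n - real_of_int (d n)" for n
    unfolding y_def d_def by (rule orbit_Suc)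
  assume "\<not> sum_balanced (dbar \<beta> x)"
  hence "\<exists>n i j. \<bar>bsum d i n - bsum d j n\<bar> > 1"
    unfolding sum_balanced_def d_def[symmetric] by (meson not_le)
  then obtain n where n: "\<exists>i j. \<bar>bsum d i n - bsum d j n\<bar> > 1"
    and less: "\<And>m. m < n \<Longrightarrow> \<not> (\<exists>i j. \<bar>bsum d i m - bsum d j m\<bar> > 1)"
    using exists_least_iff[of "\<lambda>n. \<exists>i j. \<bar>bsum d i n - bsum d j n\<bar> > 1"] by blast
  obtain i j where ij: "bsum d j n - bsum d i n \<ge> 2"
  proof -
    from n obtain a b where "\<bar>bsum d a n - bsum d b n\<bar> > 1" by blast
    thus ?thesis using that[of a b] that[of b a] by linarith
  qed
  have small: "bsum d b m - bsum d a m \<le> 1" if "m < n" for a b m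
    using less[OF that] by (smt (verit, best))
  have one: "bsum d j k - bsum d i k = 1" if "0 < k" "k < n" for k
  proof -
    have "bsum d j n = bsum d j k + bsum d (j + k) (n - k)"
      "bsum d i n = bsum d i k + bsum d (i + k) (n - k)"
      using bsum_add[of d j k "n - k"] bsum_add[of d i k "n - k"] that by simp_all
    thus ?thesis using small[of "n - k" "j + k" "i + k"] small[of k j i] that ij by simp
  qed
  have n2: "n \<ge> 2"
  proof (rule ccontr)
    assume "\<not> n \<ge> 2"
    hence "n = 0 \<or> n = 1" by auto
    thus False using ij close_imp_dbar_le[OF close, of j i] by (auto simp: bsum_def d_def)
  qed
  have rev: "y (j + Suc k) \<le> y (i + Suc k)" if "Suc k < n" for k
    using that
  proof (induction k)
    case 0
    have "d j = d i + 1" using one[of 1] n2 by (simp add: bsum_def)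
    moreover have "\<beta> * y j \<le> \<beta> * y i + 1"
      using close[of j i] base_gt_1 by (simp add: y_def field_simps)
    ultimately show ?case using step[of j] step[of i] by simp
  next
    case (Suc k)
    have "d (j + Suc k) = d (i + Suc k)"
      using one[of "Suc k"] one[of "Suc (Suc k)"] Suc.prems by (simp add: bsum_Suc)
    moreover have "\<beta> * y (j + Suc k) \<le> \<beta> * y (i + Suc k)"
      using Suc base_gt_1 by simp
    ultimately show ?case using step[of "j + Suc k"] step[of "i + Suc k"] by simp
  qed
  define m where "m = n - 1"
  have m: "n = Suc m" "0 < m" using n2 by (auto simp: m_def)
  have "y (j + m) \<le> y (i + m)" using rev[of "m - 1"] m by simp
  hence "d (j + m) \<le> d (i + m)"
    unfolding d_def dbar_def y_def using base_gt_1
    by (intro diff_right_mono ceiling_mono mult_left_mono) auto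
  moreover have "bsum d j n - bsum d i n = 1 + d (j + m) - d (i + m)"
    using one[of m] m by (simp add: bsum_Suc)
  ultimately show False using ij by simp
qed

lemma sum_balanced_binary:
  assumes "0 < x" "sum_balanced (dbar \<beta> x)"
  obtains a where "range (dbar \<beta> x) \<subseteq> {a, a + 1}"
proof -
  \<comment> \<open>The digits are nonnegative, so passing to \<open>nat\<close> allows
    well-ordering to pick a smallest one.\<close>
  obtain n where n: "\<And>m. nat (dbar \<beta> x n) \<le> nat (dbar \<beta> x m)"
    using exists_least_iff[of "\<lambda>k. \<exists>n. k = nat (dbar \<beta> x n)"] by (metis not_le)
  have "dbar \<beta> x m \<in> {dbar \<beta> x n, dbar \<beta> x n + 1}" for m
  proof -
    have "dbar \<beta> x n \<le> dbar \<beta> x m"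
      using n[of m] dbar_nonneg[OF assms(1)] by (metis int_nat_eq zle_int)
    moreover have "dbar \<beta> x m \<le> dbar \<beta> x n + 1"
      using assms(2)[unfolded sum_balanced_def, rule_format, of m 1 n] by (simp add: bsum_def)
    ultimately show ?thesis by auto
  qed
  thus ?thesis using that by blast
qed

text \<open>A point whose deviation is almost minimal has digit sums \<open>\<lceil>k\<alpha>\<rceil>\<close> for all small \<open>k\<close>.\<close>

lemma slope_sup_approx_start:
  assumes sl: "has_slope d \<alpha>" and e: "0 < e"
  shows "\<exists>n. slope_sup \<alpha> \<le> phi \<beta> (\<lambda>k. real_of_int (bsum d n k)) + e"
proof -
  obtain K where K: "\<And>s t. linear_growth (\<bar>\<alpha>\<bar> + 1) s \<Longrightarrow> linear_growth (\<bar>\<alpha>\<bar> + 1) t \<Longrightarrow>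
    (\<And>k. k < K \<Longrightarrow> s k \<le> t k) \<Longrightarrow> phi \<beta> s \<le> phi \<beta> t + e"
    using phi_approx[OF e] by blast
  have "0 < real k * \<alpha> - (real_of_int \<lceil>real k * \<alpha>\<rceil> - 1)" for k by linarith
  with finite_lower_bound[of K "\<lambda>k. real k * \<alpha> - (real_of_int \<lceil>real k * \<alpha>\<rceil> - 1)"]
  obtain \<epsilon> where \<epsilon>: "0 < \<epsilon>"
    "\<And>k. k < K \<Longrightarrow> \<epsilon> < real k * \<alpha> - (real_of_int \<lceil>real k * \<alpha>\<rceil> - 1)" by blast
  define v where "v = (INF n. deviation d \<alpha> n)"
  have "\<exists>y \<in> range (deviation d \<alpha>). y < v + \<epsilon>"
    using \<epsilon>(1) by (intro cInf_lessD) (auto simp: v_def)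
  then obtain n where n: "deviation d \<alpha> n < v + \<epsilon>" by auto
  have "real_of_int \<lceil>real k * \<alpha>\<rceil> \<le> real_of_int (bsum d n k)" if "k < K" for k
  proof -
    have "v \<le> deviation d \<alpha> (n + k)"
      unfolding v_def by (rule cINF_lower[OF deviation_bdd(2)[OF sl]]) simp
    hence "real_of_int (\<lceil>real k * \<alpha>\<rceil> - 1) < real_of_int (bsum d n k)"
      using deviation_diff[of d \<alpha> n k] n \<epsilon>(2)[OF that] by simp
    hence "\<lceil>real k * \<alpha>\<rceil> \<le> bsum d n k" unfolding of_int_less_iff by simp
    thus ?thesis by simp
  qed
  thus ?thesis unfolding slope_sup_def
    using K[OF linear_growth_ceiling linear_growth_slope[OF sl]] by blast
qed

text \<open>The mirror image under negation, since
  \<open>slope_sup (- \<alpha>) = - slope_inf \<alpha>\<close>.\<close>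

lemma slope_inf_approx_start:
  assumes sl: "has_slope d \<alpha>" and e: "0 < e"
  shows "\<exists>n. phi \<beta> (\<lambda>k. real_of_int (bsum d n k)) \<le> slope_inf \<alpha> + e"
proof -
  obtain n where n: "slope_sup (- \<alpha>) \<le> phi \<beta> (\<lambda>k. real_of_int (bsum (\<lambda>n. - d n) n k)) + e"
    using slope_sup_approx_start[OF has_slope_uminus[OF sl] e] by blast
  have "slope_sup (- \<alpha>) = - slope_inf \<alpha>"
    unfolding slope_sup_def slope_inf_def
    using phi_uminus[OF linear_growth_floor[of \<alpha>]] by (simp add: ceiling_def)
  moreover have "phi \<beta> (\<lambda>k. real_of_int (bsum (\<lambda>n. - d n) n k))
      = - phi \<beta> (\<lambda>k. real_of_int (bsum d n k))"
    unfolding bsum_uminus using phi_uminus[OF linear_growth_slope[OF sl, of n]] by simp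
  ultimately show ?thesis using n by (intro exI[of _ n]) simp
qed

text \<open>Working in the tail from \<open>N\<close> produces approximations arbitrarily late in
  the orbit, as closures of tails require.\<close>

lemma slope_sup_approx:
  assumes "x \<in> {0..1}" and sl: "has_slope (dbar \<beta> x) \<alpha>" and e: "0 < e"
  shows "\<exists>n\<ge>N. slope_sup \<alpha> \<le> (Tbar \<beta> ^^ n) x + e"
proof -
  obtain n where "slope_sup \<alpha> \<le> phi \<beta> (\<lambda>k. real_of_int (bsum (\<lambda>n. dbar \<beta> x (n + N)) n k)) + e"
    using slope_sup_approx_start[OF has_slope_shift[OF sl] e] by blast
  thus ?thesis using orbit_eq_phi[OF assms(1), of "n + N"]
    by (intro exI[of _ "n + N"]) (simp add: bsum_shift)
qed

lemma slope_inf_approx: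
  assumes "x \<in> {0..1}" and sl: "has_slope (dbar \<beta> x) \<alpha>" and e: "0 < e"
  shows "\<exists>n. (Tbar \<beta> ^^ n) x \<le> slope_inf \<alpha> + e"
  using slope_inf_approx_start[OF sl e] orbit_eq_phi[OF assms(1)] by auto

section \<open>Orbit bounds and the diameter\<close>

lemma slope_sup_le:
  assumes "x \<in> {0..1}" "has_slope (dbar \<beta> x) \<alpha>" "\<And>n. (Tbar \<beta> ^^ n) x \<le> c"
  shows "slope_sup \<alpha> \<le> c"
proof (rule field_le_epsilon)
  fix e :: real assume "0 < e"
  then obtain n where "slope_sup \<alpha> \<le> (Tbar \<beta> ^^ n) x + e"
    using slope_sup_approx[OF assms(1,2), of e 0] by blast
  thus "slope_sup \<alpha> \<le> c + e" using assms(3)[of n] by simp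
qed

lemma slope_inf_ge:
  assumes "x \<in> {0..1}" "has_slope (dbar \<beta> x) \<alpha>" "\<And>n. c \<le> (Tbar \<beta> ^^ n) x"
  shows "c \<le> slope_inf \<alpha>"
proof (rule field_le_epsilon)
  fix e :: real assume "0 < e"
  then obtain n where "(Tbar \<beta> ^^ n) x \<le> slope_inf \<alpha> + e"
    using slope_inf_approx[OF assms(1,2), of e] by blast
  thus "c \<le> slope_inf \<alpha> + e" using assms(3)[of n] by simp
qed

text \<open>The lower bound on the diameter that serves mechanical and skew words alike.\<close>

lemma Diam_ge_slope_width:
  assumes "x \<in> {0..1}" "has_slope (dbar \<beta> x) \<alpha>"
  shows "slope_sup \<alpha> - slope_inf \<alpha> \<le> Diam \<beta> x"
proof -
  have "slope_sup \<alpha> \<le> (SUP n. (Tbar \<beta> ^^ n) x)"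
    using orbit_unit[OF assms(1)]
    by (intro slope_sup_le[OF assms] cSUP_upper bdd_aboveI[of _ 1]) auto
  moreover have "(INF n. (Tbar \<beta> ^^ n) x) \<le> slope_inf \<alpha>"
    using orbit_unit[OF assms(1)]
    by (intro slope_inf_ge[OF assms] cINF_lower bdd_belowI[of _ 0]) auto
  ultimately show ?thesis by (simp add: Diam_def)
qed

text \<open>The floor and ceiling bounds on block sums carry over because \<open>phi\<close> is
  monotone.\<close>

lemma mechanical_orbit_bounds:
  assumes "x \<in> {0..1}" "mechanical_word \<alpha> (dbar \<beta> x)"
  shows "slope_inf \<alpha> \<le> (Tbar \<beta> ^^ n) x" "(Tbar \<beta> ^^ n) x \<le> slope_sup \<alpha>"
  unfolding orbit_eq_phi[OF assms(1)] slope_inf_def slope_sup_def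
  using mechanical_word_bsum[OF assms(2)]
  by (auto intro!: phi_mono[OF linear_growth_floor linear_growth_dbar[OF assms(1)]]
      phi_mono[OF linear_growth_dbar[OF assms(1)] linear_growth_ceiling])

lemma Diam_mechanical:
  assumes "x \<in> {0..1}" "has_slope (dbar \<beta> x) \<alpha>" "mechanical_word \<alpha> (dbar \<beta> x)"
  shows "Diam \<beta> x = slope_sup \<alpha> - slope_inf \<alpha>"
proof (rule antisym)
  have "(SUP n. (Tbar \<beta> ^^ n) x) \<le> slope_sup \<alpha>"
    using mechanical_orbit_bounds(2)[OF assms(1,3)] by (intro cSUP_least) auto
  moreover have "slope_inf \<alpha> \<le> (INF n. (Tbar \<beta> ^^ n) x)"
    using mechanical_orbit_bounds(1)[OF assms(1,3)] by (intro cINF_greatest) auto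
  ultimately show "Diam \<beta> x \<le> slope_sup \<alpha> - slope_inf \<alpha>" by (simp add: Diam_def)
qed (rule Diam_ge_slope_width[OF assms(1,2)])

lemma close_imp_slope:
  assumes "0 < x" "\<And>i j. (Tbar \<beta> ^^ i) x - (Tbar \<beta> ^^ j) x \<le> 1 / \<beta>"
  obtains \<alpha> where "has_slope (dbar \<beta> x) \<alpha>" "0 \<le> \<alpha>"
proof -
  obtain \<alpha> where \<alpha>: "has_slope (dbar \<beta> x) \<alpha>"
    using sum_balanced_imp_slope[OF close_imp_sum_balanced[OF assms(2)]] .
  show ?thesis using that[OF \<alpha> has_slope_nonneg[OF \<alpha> dbar_nonneg[OF assms(1)]]] .
qed

end

section \<open>The maximal slope\<close>

lemma mechanical_has_slope:
  assumes "mechanical_word \<alpha> d"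
  shows "has_slope d \<alpha>"
  unfolding has_slope_def
proof (intro allI)
  fix i n
  show "\<bar>real_of_int (bsum d i n) - real n * \<alpha>\<bar> \<le> 1"
    using mechanical_word_bsum[OF assms, where n = i and k = n] by linarith
qed

lemma mechanical_word_upper: "0 \<le> \<alpha> \<Longrightarrow> mechanical_word \<alpha> (upper_mechanical \<alpha> 0)"
  unfolding mechanical_word_def by (intro conjI bexI[of _ 0]) simp_all

text \<open>The deviations form the orbit of 0 under rotation by \<open>- \<alpha>\<close>, which is
  dense for irrational \<open>\<alpha>\<close>.\<close>

lemma deviation_upper_mechanical: "deviation (upper_mechanical \<alpha> 0) \<alpha> n = frac (real n * - \<alpha>)"
  by (simp add: deviation_def bsum_upper_mechanical frac_def ceiling_def mult.commute)

lemma frac_multiple_between: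
  fixes \<theta> :: real
  assumes "\<theta> \<notin> \<rat>" "0 \<le> a" "a < b" "b \<le> 1"
  obtains m :: nat where "a < frac (real m * \<theta>)" "frac (real m * \<theta>) < b"
proof -
  obtain m :: nat where "\<bar>frac (real m * \<theta>) - (a + b) / 2\<bar> < (b - a) / 2"
    using Kronecker_approx_1_explicit[of \<theta> "(a + b) / 2" "(b - a) / 2"] assms by auto
  thus ?thesis using that[of m] by (simp add: abs_less_iff field_simps)
qed

text \<open>The slope cancels in the difference, leaving an integer of absolute value below
  1.\<close>

lemma bsum_eqI:
  assumes "\<bar>deviation d \<alpha> k - (deviation d' \<alpha> (m + k) - deviation d' \<alpha> m)\<bar> < 1"
  shows "bsum d' m k = bsum d 0 k"
proof -
  have "\<bar>real_of_int (bsum d 0 k - bsum d' m k)\<bar> < 1"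
    using assms deviation_diff[of d' \<alpha> m k] by (simp add: deviation_def)
  thus ?thesis by linarith
qed

text \<open>The deviations of \<open>d\<close> lie in a window \<open>[v, v + 1]\<close>, of which irrationality allows at most one
  end point to be attained. The rotation orbit is dense, so it contains a point close to \<open>-v\<close>, on the
  side dictated by that end point; the digits read from there on agree with those of \<open>d\<close>.\<close>

lemma irrational_slope_prefix:
  assumes irr: "\<alpha> \<notin> \<rat>" and sl: "has_slope d \<alpha>"
  obtains m where "\<And>k. k < K \<Longrightarrow> bsum (upper_mechanical \<alpha> 0) m k = bsum d 0 k"
proof -
  define E where "E = deviation d \<alpha>"
  define F where "F = (\<lambda>n. deviation (upper_mechanical \<alpha> 0) \<alpha> n)"
  define v where "v = (INF n. E n)"
  have F: "F n = frac (real n * - \<alpha>)" "0 \<le> F n" "F n < 1" for n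
    unfolding F_def deviation_upper_mechanical by (simp_all add: frac_lt_1)
  have irr': "- \<alpha> \<notin> \<rat>" using irr by simp
  have lo: "v \<le> E n" for n
    unfolding v_def E_def by (rule cINF_lower[OF deviation_bdd(2)[OF sl]]) simp
  have hi: "E n \<le> v + 1" for n
  proof -
    have "E n - 1 \<le> v"
      unfolding v_def E_def
      by (rule cINF_greatest) (use deviation_close[OF sl, of n] in \<open>auto simp: algebra_simps\<close>)
    thus ?thesis by simp
  qed
  have E0: "E 0 = 0" by (simp add: E_def)
  show ?thesis
  proof (cases "\<exists>j. E j = v + 1")
    case False
    hence lt: "0 < v + 1 - E k" for k using hi[of k] by (metis diff_gt_0_iff_gt less_eq_real_def)
    obtain \<epsilon> where \<epsilon>: "0 < \<epsilon>" "\<And>k. k < Suc K \<Longrightarrow> \<epsilon> < v + 1 - E k"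
      using finite_lower_bound[of "Suc K" "\<lambda>k. v + 1 - E k"] lt by blast
    have e0: "\<epsilon> < v + 1" using \<epsilon>(2)[of 0] E0 by simp
    obtain m where m: "- v < F m" "F m < - v + \<epsilon>"
      using frac_multiple_between[OF irr', of "- v" "- v + \<epsilon>"] lo[of 0] E0 e0 \<epsilon>(1) F(1) by auto
    have "bsum (upper_mechanical \<alpha> 0) m k = bsum d 0 k" if "k < K" for k
    proof (rule bsum_eqI)
      have "\<bar>E k - (F (m + k) - F m)\<bar> < 1"
        using \<epsilon>(2)[of k] that lo[of k] m F(2,3)[of "m + k"] by (simp add: abs_less_iff)
      thus "\<bar>deviation d \<alpha> k - (deviation (upper_mechanical \<alpha> 0) \<alpha> (m + k)
          - deviation (upper_mechanical \<alpha> 0) \<alpha> m)\<bar> < 1" by (simp add: E_def F_def)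
    qed
    thus ?thesis using that by blast
  next
    case True
    then obtain j where j: "E j = v + 1" by blast
    have gt: "0 < E k - v" for k
    proof (rule ccontr)
      assume "\<not> 0 < E k - v"
      hence "E j = E k + 1" using lo[of k] j by simp
      hence *: "real_of_int (bsum d 0 j - bsum d 0 k - 1) = (real j - real k) * \<alpha>" and "j \<noteq> k"
        by (auto simp: E_def deviation_def algebra_simps)
      hence "\<alpha> = real_of_int (bsum d 0 j - bsum d 0 k - 1) / (real j - real k)"
        by (simp add: field_simps)
      hence "\<alpha> \<in> \<rat>" by simp
      thus False using irr by simp
    qed
    obtain \<epsilon> where \<epsilon>: "0 < \<epsilon>" "\<And>k. k < Suc K \<Longrightarrow> \<epsilon> < E k - v"
      using finite_lower_bound[of "Suc K" "\<lambda>k. E k - v"] gt by blast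
    have e0: "\<epsilon> < - v" using \<epsilon>(2)[of 0] E0 by simp
    obtain m where m: "- v - \<epsilon> < F m" "F m < - v"
      using frac_multiple_between[OF irr', of "- v - \<epsilon>" "- v"] hi[of 0] E0 e0 \<epsilon>(1) F(1) by auto
    have "bsum (upper_mechanical \<alpha> 0) m k = bsum d 0 k" if "k < K" for k
    proof (rule bsum_eqI)
      have "\<bar>E k - (F (m + k) - F m)\<bar> < 1"
        using \<epsilon>(2)[of k] that hi[of k] m F(2,3)[of "m + k"] by (simp add: abs_less_iff)
      thus "\<bar>deviation d \<alpha> k - (deviation (upper_mechanical \<alpha> 0) \<alpha> (m + k)
          - deviation (upper_mechanical \<alpha> 0) \<alpha> m)\<bar> < 1" by (simp add: E_def F_def)
    qed
    thus ?thesis using that by blast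
  qed
qed

lemma Rats_coprime_quotient:
  fixes \<alpha> :: real
  assumes "\<alpha> \<in> \<rat>"
  obtains p :: int and q :: nat where "q \<ge> 1" "coprime p (int q)" "\<alpha> = real_of_int p / real q"
  using assms
proof (cases rule: Rats_cases')
  case (1 a b)
  thus ?thesis using that[of "nat b" a] by simp
qed

context base
begin

definition max_slope :: real where
  "max_slope = Sup {\<alpha>. 0 \<le> \<alpha> \<and> slope_sup \<alpha> \<le> 1}"

lemma slope_sup_0: "slope_sup 0 = 0"
  by (simp add: slope_sup_def phi_def)

text \<open>A crude bound, from \<open>\<lceil>real k * \<alpha>\<rceil> \<ge> \<alpha>\<close> for
  positive \<open>k\<close>; it makes the set defining \<open>max_slope\<close> bounded.\<close>

lemma slope_sup_ge:
  assumes "0 \<le> \<alpha>"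
  shows "\<alpha> / \<beta> \<le> slope_sup \<alpha>"
proof -
  have g: "linear_growth \<alpha> (\<lambda>k. \<alpha> * (if k = 0 then 0 else 1))"
    using assms by (simp add: linear_growth_def mult_left_mono)
  have "\<alpha> / \<beta> = phi \<beta> (\<lambda>k. \<alpha> * (if k = 0 then 0 else 1))"
    using suminf_mult[OF linear_growth_summable[OF linear_growth_positive], of \<alpha>] phi_positive
    by (simp add: phi_def mult.left_commute del: mult_zero_right)
  also have "\<dots> \<le> slope_sup \<alpha>"
    unfolding slope_sup_def
  proof (rule phi_mono[OF g linear_growth_ceiling])
    fix k
    show "\<alpha> * (if k = 0 then 0 else 1) \<le> real_of_int \<lceil>real k * \<alpha>\<rceil>"
    proof (cases "k = 0")
      case False
      hence "1 * \<alpha> \<le> real k * \<alpha>" using assms by (intro mult_right_mono) auto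
      also have "\<dots> \<le> real_of_int \<lceil>real k * \<alpha>\<rceil>" by simp
      finally show ?thesis using False by simp
    qed simp
  qed
  finally show ?thesis .
qed

lemma max_slope_bdd: "bdd_above {\<alpha>. 0 \<le> \<alpha> \<and> slope_sup \<alpha> \<le> 1}"
proof (rule bdd_aboveI[of _ \<beta>])
  fix \<alpha> assume "\<alpha> \<in> {\<alpha>. 0 \<le> \<alpha> \<and> slope_sup \<alpha> \<le> 1}"
  hence "\<alpha> / \<beta> \<le> 1" using slope_sup_ge[of \<alpha>] by simp
  thus "\<alpha> \<le> \<beta>" using base_gt_1 by (simp add: field_simps)
qed

lemma le_max_slope: "0 \<le> \<alpha> \<Longrightarrow> slope_sup \<alpha> \<le> 1 \<Longrightarrow> \<alpha> \<le> max_slope"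
  unfolding max_slope_def by (rule cSup_upper[OF _ max_slope_bdd]) simp

lemma max_slope_nonneg: "0 \<le> max_slope"
  using le_max_slope[of 0] by (simp add: slope_sup_0)

text \<open>The supremum is attained: ceilings are continuous from the left, so an admissible slope
  just below \<open>max_slope\<close> has ceilings at least as large for the first \<open>K\<close>
  multiples.\<close>

lemma slope_sup_max_slope: "slope_sup max_slope \<le> 1"
proof (rule field_le_epsilon)
  fix e :: real assume e: "0 < e"
  obtain K where K: "\<And>s t. linear_growth (\<bar>max_slope\<bar> + 1) s \<Longrightarrow> linear_growth (\<bar>max_slope\<bar> + 1) t \<Longrightarrow>
    (\<And>k. k < K \<Longrightarrow> s k \<le> t k) \<Longrightarrow> phi \<beta> s \<le> phi \<beta> t + e"
    using phi_approx[OF e] by blast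
  \<comment> \<open>The room that a multiple has before its ceiling drops.\<close>
  have "0 < real k * max_slope - (real_of_int \<lceil>real k * max_slope\<rceil> - 1)" for k by linarith
  with finite_lower_bound[of K "\<lambda>k. real k * max_slope - (real_of_int \<lceil>real k * max_slope\<rceil> - 1)"]
  obtain \<epsilon> where \<epsilon>: "0 < \<epsilon>"
    "\<And>k. k < K \<Longrightarrow> \<epsilon> < real k * max_slope - (real_of_int \<lceil>real k * max_slope\<rceil> - 1)" by blast
  obtain \<delta> where \<delta>: "0 < \<delta>" "\<And>k. k < K \<Longrightarrow> real k * \<delta> \<le> \<epsilon>"
    using small_multiples[OF \<epsilon>(1), of K] by blast
  have "\<exists>\<alpha>\<in>{\<alpha>. 0 \<le> \<alpha> \<and> slope_sup \<alpha> \<le> 1}. max_slope - \<delta> < \<alpha>"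
    by (rule less_cSupD) (use slope_sup_0 \<delta>(1) in \<open>auto simp: max_slope_def intro: exI[of _ 0]\<close>)
  then obtain \<alpha> where \<alpha>: "0 \<le> \<alpha>" "slope_sup \<alpha> \<le> 1" "max_slope - \<delta> < \<alpha>" by auto
  have "real_of_int \<lceil>real k * max_slope\<rceil> \<le> real_of_int \<lceil>real k * \<alpha>\<rceil>" if "k < K" for k
  proof -
    have "real k * (max_slope - \<delta>) \<le> real k * \<alpha>" using \<alpha>(3) by (intro mult_left_mono) auto
    hence "real_of_int \<lceil>real k * max_slope\<rceil> - 1 < real k * \<alpha>"
      using \<epsilon>(2)[OF that] \<delta>(2)[OF that] by (simp add: algebra_simps)
    thus ?thesis by (simp add: less_ceiling_iff[symmetric]) linarith
  qed
  moreover have "linear_growth (\<bar>max_slope\<bar> + 1) (\<lambda>k. real_of_int \<lceil>real k * \<alpha>\<rceil>)"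
    using le_max_slope[OF \<alpha>(1,2)] \<alpha>(1) by (intro linear_growth_mono[OF linear_growth_ceiling]) auto
  ultimately have "slope_sup max_slope \<le> slope_sup \<alpha> + e"
    unfolding slope_sup_def using K[OF linear_growth_ceiling] by blast
  thus "slope_sup max_slope \<le> 1 + e" using \<alpha>(2) by simp
qed

text \<open>For positive \<open>k\<close>, \<open>\<lfloor>real k * \<alpha>\<rfloor> + 1\<close> is
  the limit of the ceilings as the slope decreases to \<open>\<alpha>\<close>.\<close>

lemma phi_floor_plus:
  "phi \<beta> (\<lambda>k. real_of_int \<lfloor>real k * \<alpha>\<rfloor> + (if k = 0 then 0 else 1)) = slope_inf \<alpha> + 1 / \<beta>"
  "linear_growth (\<bar>\<alpha>\<bar> + 2) (\<lambda>k. real_of_int \<lfloor>real k * \<alpha>\<rfloor> + (if k = 0 then 0 else 1))"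
proof -
  have g: "linear_growth 1 (\<lambda>k. - (if k = 0 then 0 else 1 :: real))"
    by (simp add: linear_growth_def)
  show "phi \<beta> (\<lambda>k. real_of_int \<lfloor>real k * \<alpha>\<rfloor> + (if k = 0 then 0 else 1)) = slope_inf \<alpha> + 1 / \<beta>"
    using phi_diff[OF linear_growth_floor[of \<alpha>] g] phi_uminus[OF linear_growth_positive] phi_positive
    by (simp add: slope_inf_def)
  show "linear_growth (\<bar>\<alpha>\<bar> + 2) (\<lambda>k. real_of_int \<lfloor>real k * \<alpha>\<rfloor> + (if k = 0 then 0 else 1))"
    using linear_growth_diff[OF linear_growth_floor[of \<alpha>] g] by (simp add: add.commute)
qed

text \<open>Slopes just above \<open>max_slope\<close> have \<open>slope_sup\<close> greater than 1,
  but at most \<open>slope_inf max_slope + 1 / \<beta>\<close> up to a small error.\<close>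

lemma slope_inf_max_slope: "1 - 1 / \<beta> \<le> slope_inf max_slope"
proof (rule field_le_epsilon)
  fix e :: real assume e: "0 < e"
  obtain K where K: "\<And>s t. linear_growth (\<bar>max_slope\<bar> + 2) s \<Longrightarrow> linear_growth (\<bar>max_slope\<bar> + 2) t \<Longrightarrow>
    (\<And>k. k < K \<Longrightarrow> s k \<le> t k) \<Longrightarrow> phi \<beta> s \<le> phi \<beta> t + e"
    using phi_approx[OF e] by blast
  have "0 < real_of_int \<lfloor>real k * max_slope\<rfloor> + 1 - real k * max_slope" for k by linarith
  with finite_lower_bound[of K "\<lambda>k. real_of_int \<lfloor>real k * max_slope\<rfloor> + 1 - real k * max_slope"]
  obtain \<epsilon> where \<epsilon>: "0 < \<epsilon>"
    "\<And>k. k < K \<Longrightarrow> \<epsilon> < real_of_int \<lfloor>real k * max_slope\<rfloor> + 1 - real k * max_slope" by blast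
  obtain \<delta> where \<delta>: "0 < \<delta>" "\<delta> \<le> 1" "\<And>k. k < K \<Longrightarrow> real k * \<delta> \<le> \<epsilon>"
    using small_multiples[OF \<epsilon>(1), of K] by blast
  define \<alpha> where "\<alpha> = max_slope + \<delta>"
  have "real_of_int \<lceil>real k * \<alpha>\<rceil> \<le> real_of_int \<lfloor>real k * max_slope\<rfloor> + (if k = 0 then 0 else 1)"
    if "k < K" for k
  proof -
    have "real k * \<alpha> \<le> real_of_int (\<lfloor>real k * max_slope\<rfloor> + 1)"
      using \<epsilon>(2)[OF that] \<delta>(3)[OF that] by (simp add: \<alpha>_def algebra_simps)
    hence "\<lceil>real k * \<alpha>\<rceil> \<le> \<lfloor>real k * max_slope\<rfloor> + 1" by (rule ceiling_le)
    thus ?thesis by (cases "k = 0") simp_all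
  qed
  moreover have "linear_growth (\<bar>max_slope\<bar> + 2) (\<lambda>k. real_of_int \<lceil>real k * \<alpha>\<rceil>)"
    using \<delta> max_slope_nonneg by (intro linear_growth_mono[OF linear_growth_ceiling]) (simp add: \<alpha>_def)
  ultimately have "slope_sup \<alpha> \<le> slope_inf max_slope + 1 / \<beta> + e"
    unfolding slope_sup_def phi_floor_plus(1)[symmetric] using K[OF _ phi_floor_plus(2)] by blast
  moreover have "\<not> slope_sup \<alpha> \<le> 1"
    using le_max_slope[of \<alpha>] \<delta>(1) max_slope_nonneg by (auto simp: \<alpha>_def)
  ultimately show "1 - 1 / \<beta> \<le> slope_inf max_slope + e" by simp
qed

text \<open>The upper end of the interval gives \<open>\<alpha> \<le> max_slope\<close>. A strictly
  smaller slope would give \<open>slope_inf \<alpha> + 1 / \<beta> < slope_sup max_slope \<le>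
  1\<close>, against the lower end.\<close>

lemma upper_orbit_slope:
  assumes "x \<in> {0..1}" and orb: "\<And>n. (Tbar \<beta> ^^ n) x \<in> {1 - 1 / \<beta>..1}"
  shows "has_slope (dbar \<beta> x) max_slope"
    "\<exists>N. mechanical_word max_slope (\<lambda>n. dbar \<beta> x (n + N))"
proof -
  have close: "(Tbar \<beta> ^^ i) x - (Tbar \<beta> ^^ j) x \<le> 1 / \<beta>" for i j
    using orb[of i] orb[of j] by simp
  have pos: "0 < x" using orb[of 0] scale_pos by simp
  obtain \<alpha> where \<alpha>: "has_slope (dbar \<beta> x) \<alpha>" "0 \<le> \<alpha>" using close_imp_slope[OF pos close] .
  have "slope_sup \<alpha> \<le> 1" using orb by (intro slope_sup_le[OF assms(1) \<alpha>(1)]) auto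
  hence le: "\<alpha> \<le> max_slope" using le_max_slope \<alpha>(2) by simp
  have inf: "1 - 1 / \<beta> \<le> slope_inf \<alpha>" using orb by (intro slope_inf_ge[OF assms(1) \<alpha>(1)]) auto
  have eq: "\<alpha> = max_slope"
  proof (rule ccontr)
    assume "\<alpha> \<noteq> max_slope"
    hence lt: "\<alpha> < max_slope" using le by simp
    \<comment> \<open>At this index the comparison of the two sequences is strict.\<close>
    obtain j :: nat where j: "1 < real j * (max_slope - \<alpha>)"
      using reals_Archimedean3[of "max_slope - \<alpha>"] lt by auto
    have "phi \<beta> (\<lambda>k. real_of_int \<lfloor>real k * \<alpha>\<rfloor> + (if k = 0 then 0 else 1)) < slope_sup max_slope"
      unfolding slope_sup_def
    proof (rule phi_strict_mono[OF phi_floor_plus(2) linear_growth_ceiling])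
      fix k :: nat
      show "real_of_int \<lfloor>real k * \<alpha>\<rfloor> + (if k = 0 then 0 else 1) \<le> real_of_int \<lceil>real k * max_slope\<rceil>"
      proof (cases "k = 0")
        case False
        hence "real k * \<alpha> < real k * max_slope" using lt by simp
        hence "\<lfloor>real k * \<alpha>\<rfloor> < \<lceil>real k * max_slope\<rceil>" by linarith
        thus ?thesis using False by simp
      qed simp
    next
      have "real_of_int \<lfloor>real j * \<alpha>\<rfloor> + 1 \<le> real j * \<alpha> + 1" by simp
      also have "\<dots> < real j * max_slope" using j by (simp add: algebra_simps)
      also have "\<dots> \<le> real_of_int \<lceil>real j * max_slope\<rceil>" by simp
      finally show "real_of_int \<lfloor>real j * \<alpha>\<rfloor> + (if j = 0 then 0 else 1)
          < real_of_int \<lceil>real j * max_slope\<rceil>"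
        using j by (cases "j = 0") simp_all
    qed
    thus False using inf slope_sup_max_slope by (simp add: phi_floor_plus(1))
  qed
  show "has_slope (dbar \<beta> x) max_slope" using \<alpha>(1) eq by simp
  show "\<exists>N. mechanical_word max_slope (\<lambda>n. dbar \<beta> x (n + N))"
    using mechanical_or_skew[OF close_imp_sum_balanced[OF close] \<alpha>] unfolding eq
    by (auto intro: exI[of _ 0])
qed

end

section \<open>The invariant orbit closure\<close>

lemma funpow_image_eq: "f ` S = S \<Longrightarrow> (f ^^ n) ` S = S"
  by (induction n) (simp_all only: funpow.simps image_comp[symmetric] image_id id_apply)

lemma inj_on_funpow:
  assumes "inj_on f S" "f ` S = S"
  shows "inj_on (f ^^ n) S"
proof (induction n)
  case (Suc n)
  have "inj_on (f \<circ> f ^^ n) S"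
    using Suc assms(1) funpow_image_eq[OF assms(2), of n] by (intro comp_inj_on) simp_all
  thus ?case by (simp only: funpow.simps)
qed simp

context base
begin

abbreviation "top_point \<equiv> slope_sup max_slope"

abbreviation "orbit x \<equiv> (\<lambda>n. (Tbar \<beta> ^^ n) x)"

text \<open>The values of \<open>phi\<close> along the upper mechanical word satisfy the recurrence
  of an orbit, and the two bounds for \<open>max_slope\<close> keep them in
  \<open>[1 - 1 / \<beta>, 1]\<close>.\<close>

lemma top_point_orbit:
  shows "(Tbar \<beta> ^^ n) top_point \<in> {1 - 1 / \<beta>..1}"
    and "(Tbar \<beta> ^^ n) top_point \<le> top_point"
    and "dbar \<beta> top_point n = upper_mechanical max_slope 0 n"
proof -
  define d where "d = upper_mechanical max_slope 0"
  define y where "y = (\<lambda>n. phi \<beta> (\<lambda>k. real_of_int (bsum d n k)))"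
  have mech: "mechanical_word max_slope d"
    unfolding d_def by (rule mechanical_word_upper[OF max_slope_nonneg])
  note growth = linear_growth_slope[OF mechanical_has_slope[OF mech]]
  have y0: "y 0 = top_point"
    unfolding y_def slope_sup_def d_def bsum_upper_mechanical by (simp add: mult.commute)
  have up: "y n \<le> top_point" for n
    unfolding y_def slope_sup_def using mechanical_word_bsum(2)[OF mech]
    by (intro phi_mono[OF growth linear_growth_ceiling]) simp
  have lo: "slope_inf max_slope \<le> y n" for n
    unfolding y_def slope_inf_def using mechanical_word_bsum(1)[OF mech]
    by (intro phi_mono[OF linear_growth_floor growth]) simp
  have pos: "0 < y n" for n using lo[of n] slope_inf_max_slope scale_pos by simp
  have le1: "y n \<le> 1" for n using up[of n] slope_sup_max_slope by simp
  have step: "y (Suc n) = \<beta> * y n - real_of_int (d n)" for n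
    using phi_shift[OF growth[of n]] unfolding y_def bsum_Suc_left One_nat_def by simp
  note o = orbit_of_recurrence[of y d, OF pos le1 step, unfolded y0]
  show "(Tbar \<beta> ^^ n) top_point \<in> {1 - 1 / \<beta>..1}"
    using o(1)[of n] lo[of n] slope_inf_max_slope le1[of n] by simp
  show "(Tbar \<beta> ^^ n) top_point \<le> top_point" using o(1) up by simp
  show "dbar \<beta> top_point n = upper_mechanical max_slope 0 n" using o(2) by (simp add: d_def)
qed

lemma top_point_unit: "top_point \<in> {0..1}"
  using top_point_orbit(1)[of 0] scale_pos by auto

lemma top_point_slope: "has_slope (dbar \<beta> top_point) max_slope"
  by (rule upper_orbit_slope(1)[OF top_point_unit top_point_orbit(1)])

text \<open>Late orbit points come close to \<open>slope_sup max_slope\<close> by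
  \<open>slope_sup_approx\<close> and do not exceed it.\<close>

lemma top_point_in_closure:
  assumes x: "x \<in> {0..1}" and sl: "has_slope (dbar \<beta> x) max_slope"
    and up: "\<And>n. n \<ge> N \<Longrightarrow> (Tbar \<beta> ^^ n) x \<le> top_point"
  shows "top_point \<in> closure (orbit x ` {N..})"
  unfolding closure_approachable
proof (intro allI impI)
  fix e :: real assume "0 < e"
  then obtain n where n: "n \<ge> N" "top_point \<le> (Tbar \<beta> ^^ n) x + e / 2"
    using slope_sup_approx[OF x sl, of "e / 2" N] by auto
  hence "dist ((Tbar \<beta> ^^ n) x) top_point < e"
    using up[OF n(1)] \<open>0 < e\<close> by (simp add: dist_real_def)
  thus "\<exists>y\<in>orbit x ` {N..}. dist y top_point < e" using n(1) by auto
qed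

lemma upper_orbit_eventually_le:
  assumes "x \<in> {0..1}" and "\<And>n. (Tbar \<beta> ^^ n) x \<in> {1 - 1 / \<beta>..1}"
  obtains N where "mechanical_word max_slope (\<lambda>n. dbar \<beta> x (n + N))"
    "\<And>n. n \<ge> N \<Longrightarrow> (Tbar \<beta> ^^ n) x \<le> top_point"
proof -
  obtain N where N: "mechanical_word max_slope (\<lambda>n. dbar \<beta> x (n + N))"
    using upper_orbit_slope(2)[OF assms] by blast
  have "(Tbar \<beta> ^^ n) x \<le> top_point" if "n \<ge> N" for n
    using mechanical_orbit_bounds(2)[OF orbit_unit[OF assms(1), of N], of max_slope "n - N"] N that
    by (simp add: dbar_shift orbit_add)
  thus ?thesis using that N by blast
qed

text \<open>Only one discontinuity of the map lies in the interval, and points just to the right of it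
  are mapped close to \<open>0\<close>, hence out of the interval.\<close>

lemma Tbar_continuous:
  assumes "\<beta> \<notin> \<int>"
  defines "D \<equiv> {z \<in> {1 - 1 / \<beta>..1}. Tbar \<beta> z \<in> {1 - 1 / \<beta>..1}}"
  shows "closed D" "continuous_on D (Tbar \<beta>)"
proof -
  define k where "k = real_of_int \<lfloor>\<beta>\<rfloor>"
  have "\<beta> \<noteq> k" using assms(1) by (metis Ints_of_int k_def)
  hence k: "k < \<beta>" "\<beta> < k + 1" unfolding k_def by linarith+
  define D1 where "D1 = {1 - 1 / \<beta>..k / \<beta>} \<inter> {z. \<beta> * z - (k - 1) \<in> {1 - 1 / \<beta>..1}}"
  define D2 where "D2 = {k / \<beta>..1} \<inter> {z. \<beta> * z - k \<in> {1 - 1 / \<beta>..1}}"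
  have T1: "Tbar \<beta> z = \<beta> * z - (k - 1)" if "1 - 1 / \<beta> \<le> z" "z \<le> k / \<beta>" for z
  proof -
    have "\<beta> - 1 \<le> \<beta> * z" "\<beta> * z \<le> k" using that base_gt_1 by (auto simp: field_simps)
    hence "\<lceil>\<beta> * z\<rceil> = \<lfloor>\<beta>\<rfloor>" using k by (intro ceiling_unique) (auto simp: k_def)
    thus ?thesis by (simp add: Tbar_eq k_def)
  qed
  have T2: "Tbar \<beta> z = \<beta> * z - k" if "k / \<beta> < z" "z \<le> 1" for z
  proof -
    have "k < \<beta> * z" "\<beta> * z \<le> \<beta>" using that base_gt_1 by (auto simp: field_simps)
    hence "k < \<beta> * z" "\<beta> * z \<le> k + 1" using k(2) by linarith+
    hence "\<lceil>\<beta> * z\<rceil> = \<lfloor>\<beta>\<rfloor> + 1" by (intro ceiling_unique) (simp_all add: k_def)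
    thus ?thesis by (simp add: Tbar_eq k_def)
  qed
  have D2_gt: "k / \<beta> < z" if "z \<in> D2" for z
  proof -
    have "k < \<beta> * z" using that scale_pos by (auto simp: D2_def)
    thus ?thesis using base_gt_1 by (simp add: field_simps)
  qed
  have "(\<beta> - 1) / \<beta> \<le> k / \<beta>" "k / \<beta> \<le> \<beta> / \<beta>"
    using k base_gt_1 by (intro divide_right_mono; simp)+
  hence k_bounds: "1 - 1 / \<beta> \<le> k / \<beta>" "k / \<beta> \<le> 1"
    using base_gt_1 by (simp_all add: diff_divide_distrib)
  have D: "D = D1 \<union> D2"
  proof (intro set_eqI iffI)
    fix z assume z: "z \<in> D"
    show "z \<in> D1 \<union> D2"
    proof (cases "z \<le> k / \<beta>")
      case True
      thus ?thesis using z T1[of z] by (auto simp: D_def D1_def)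
    next
      case False
      thus ?thesis using z T2[of z] by (auto simp: D_def D2_def)
    qed
  next
    fix z assume "z \<in> D1 \<union> D2"
    thus "z \<in> D"
    proof
      assume "z \<in> D1"
      thus ?thesis using T1[of z] k_bounds by (auto simp: D_def D1_def)
    next
      assume "z \<in> D2"
      thus ?thesis using T2[of z] D2_gt[of z] k_bounds by (auto simp: D_def D2_def)
    qed
  qed
  have cl: "closed D1" "closed D2"
    unfolding D1_def D2_def
    by (intro closed_Int closed_atLeastAtMost closed_vimage[unfolded vimage_def] continuous_intros)+
  show "closed D" unfolding D using cl by blast
  have "continuous_on D1 (Tbar \<beta>)"
    using T1 by (subst continuous_on_cong[where g = "\<lambda>z. \<beta> * z - (k - 1)"])
      (auto simp: D1_def intro!: continuous_intros)
  moreover have "continuous_on D2 (Tbar \<beta>)"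
    using T2 D2_gt by (subst continuous_on_cong[where g = "\<lambda>z. \<beta> * z - k"])
      (auto simp: D2_def intro!: continuous_intros)
  ultimately show "continuous_on D (Tbar \<beta>)"
    unfolding D using cl by (intro continuous_on_closed_Un)
qed

section \<open>The orbit closure of the top point and its uniqueness\<close>

abbreviation "top_closure \<equiv> closure (range (orbit top_point))"

lemma top_point_in_top_closure: "top_point \<in> top_closure"
  using closure_subset[of "range (orbit top_point)"] by (metis funpow_0 rangeI subsetD)

lemma top_closure_subset: "top_closure \<subseteq> {1 - 1 / \<beta>..1}"
  using top_point_orbit(1) by (intro closure_minimal) auto

text \<open>One inclusion is continuity. For the other, the image is compact and contains all
  iterates except possibly the starting point, which is a limit of the later ones.\<close>

lemma top_closure_invariant:
  assumes "\<beta> \<notin> \<int>"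
  shows "Tbar \<beta> ` top_closure = top_closure"
proof
  let ?D = "{z \<in> {1 - 1 / \<beta>..1}. Tbar \<beta> z \<in> {1 - 1 / \<beta>..1}}"
  have "(Tbar \<beta> ^^ n) top_point \<in> ?D" for n
    using top_point_orbit(1)[of n] top_point_orbit(1)[of "Suc n"] by simp
  hence "top_closure \<subseteq> ?D" using Tbar_continuous(1)[OF assms] by (intro closure_minimal) auto
  hence cont: "continuous_on top_closure (Tbar \<beta>)"
    using Tbar_continuous(2)[OF assms] continuous_on_subset by blast
  have step: "Tbar \<beta> ((Tbar \<beta> ^^ n) top_point) = (Tbar \<beta> ^^ Suc n) top_point" for n by simp
  show "Tbar \<beta> ` top_closure \<subseteq> top_closure"
  proof (rule image_closure_subset[OF cont closed_closure])
    show "Tbar \<beta> ` range (orbit top_point) \<subseteq> top_closure"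
      using closure_subset[of "range (orbit top_point)"] by (auto simp: step simp del: funpow.simps)
  qed
  have "compact top_closure"
    using top_closure_subset by (meson bounded_closed_interval bounded_subset closed_closure compact_eq_bounded_closed)
  hence closed: "closed (Tbar \<beta> ` top_closure)"
    using compact_continuous_image[OF cont] compact_imp_closed by blast
  have tail: "orbit top_point ` {1..} \<subseteq> Tbar \<beta> ` top_closure"
  proof
    fix z assume "z \<in> orbit top_point ` {1..}"
    then obtain n where n: "n \<ge> 1" "z = (Tbar \<beta> ^^ n) top_point" by auto
    hence "z = Tbar \<beta> ((Tbar \<beta> ^^ (n - 1)) top_point)" unfolding step by simp
    moreover have "(Tbar \<beta> ^^ (n - 1)) top_point \<in> top_closure"
      using closure_subset[of "range (orbit top_point)"] by auto
    ultimately show "z \<in> Tbar \<beta> ` top_closure" by blast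
  qed
  \<comment> \<open>The tail from index 1 suffices to approximate \<open>top_point\<close>.\<close>
  have "top_point \<in> closure (orbit top_point ` {1..})"
    using top_point_in_closure[OF top_point_unit top_point_slope top_point_orbit(2)] .
  also have "\<dots> \<subseteq> Tbar \<beta> ` top_closure" by (rule closure_minimal[OF tail closed])
  finally have "(Tbar \<beta> ^^ n) top_point \<in> Tbar \<beta> ` top_closure" for n
    using tail by (cases "n = 0") auto
  thus "top_closure \<subseteq> Tbar \<beta> ` top_closure" by (intro closure_minimal closed) auto
qed

text \<open>Every prefix of the digit sums of \<open>x\<close> reappears along the orbit of
  \<open>top_point\<close>, so some orbit point is close to \<open>x\<close> by
  \<open>phi_approx\<close> in both directions.\<close>

lemma in_top_closure_irrational:
  assumes x: "x \<in> {0..1}" and sl: "has_slope (dbar \<beta> x) max_slope" and irr: "max_slope \<notin> \<rat>"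
  shows "x \<in> top_closure"
  unfolding closure_approachable
proof (intro allI impI)
  fix e :: real assume e: "0 < e"
  hence "0 < e / 2" by simp
  from phi_approx[OF this, of "\<bar>max_slope\<bar> + 1"]
  obtain K where K: "\<And>s t. linear_growth (\<bar>max_slope\<bar> + 1) s \<Longrightarrow> linear_growth (\<bar>max_slope\<bar> + 1) t \<Longrightarrow>
    (\<And>k. k < K \<Longrightarrow> s k \<le> t k) \<Longrightarrow> phi \<beta> s \<le> phi \<beta> t + e / 2" by blast
  obtain m where m: "\<And>k. k < K \<Longrightarrow> bsum (upper_mechanical max_slope 0) m k = bsum (dbar \<beta> x) 0 k"
    using irrational_slope_prefix[OF irr sl] by blast
  have d: "dbar \<beta> top_point = upper_mechanical max_slope 0" using top_point_orbit(3) by blast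
  have "(Tbar \<beta> ^^ m) top_point \<le> (Tbar \<beta> ^^ 0) x + e / 2"
    unfolding orbit_eq_phi[OF top_point_unit] orbit_eq_phi[OF x]
    by (rule K[OF linear_growth_slope[OF top_point_slope] linear_growth_slope[OF sl]]) (simp add: d m)
  moreover have "(Tbar \<beta> ^^ 0) x \<le> (Tbar \<beta> ^^ m) top_point + e / 2"
    unfolding orbit_eq_phi[OF top_point_unit] orbit_eq_phi[OF x]
    by (rule K[OF linear_growth_slope[OF sl] linear_growth_slope[OF top_point_slope]]) (simp add: d m)
  ultimately have "dist ((Tbar \<beta> ^^ m) top_point) x < e"
    using e by (simp add: dist_real_def abs_le_iff)
  thus "\<exists>y\<in>range (orbit top_point). dist y x < e" by blast
qed

text \<open>The digits are eventually periodic, and an orbit point is determined by the digits from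
  its position on.\<close>

lemma finite_orbit_rational:
  assumes x: "x \<in> {0..1}" and mech: "mechanical_word \<alpha> (\<lambda>n. dbar \<beta> x (n + N))" and rat: "\<alpha> \<in> \<rat>"
  shows "finite (range (orbit x))"
proof -
  obtain p :: int and q :: nat where q: "q \<ge> 1" "\<alpha> = real_of_int p / real q"
    using Rats_coprime_quotient[OF rat] by metis
  define d where "d = dbar \<beta> x"
  have qa: "real q * \<alpha> = real_of_int p" using q by simp
  have sum: "bsum d n q = p" if "n \<ge> N" for n
    using mechanical_word_bsum[OF mech, where n = "n - N" and k = q] that
    by (simp add: bsum_shift qa d_def)
  \<comment> \<open>The blocks of length \<open>q\<close> at \<open>n\<close> and at
    \<open>Suc n\<close> have the same sum \<open>p\<close> and share all letters but the first of
    one and the last of the other.\<close>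
  have per: "d (n + q) = d n" if "n \<ge> N" for n
    using sum[of n] sum[of "Suc n"] bsum_Suc[of d n q] bsum_Suc_left[of d n q] that by simp
  have "bsum d (n + q) k = bsum d n k" if "n \<ge> N" for n k
    unfolding bsum_def
  proof (rule sum.cong)
    fix j
    show "d (n + q + j) = d (n + j)" using per[of "n + j"] that by (simp add: ac_simps)
  qed simp
  hence step: "(Tbar \<beta> ^^ (n + q)) x = (Tbar \<beta> ^^ n) x" if "n \<ge> N" for n
    unfolding orbit_eq_phi[OF x] d_def[symmetric] using that by simp
  have "(Tbar \<beta> ^^ n) x \<in> orbit x ` {..<N + q}" for n
  proof (induction n rule: less_induct)
    case (less n)
    show ?case
    proof (cases "n < N + q")
      case False
      hence "(Tbar \<beta> ^^ n) x = (Tbar \<beta> ^^ (n - q)) x" using step[of "n - q"] by simp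
      thus ?thesis using less[of "n - q"] False q(1) by simp
    qed simp
  qed
  hence "range (orbit x) \<subseteq> orbit x ` {..<N + q}" by auto
  thus ?thesis using finite_surj by blast
qed

text \<open>\<open>S\<close> contains \<open>top_point\<close> as a limit of its orbit. For rational
  slope \<open>S\<close> is finite and the map permutes it; \<open>top_point\<close> is an iterate
  of \<open>x\<close> and, by invariance, the same iterate of a point of \<open>top_closure\<close>,
  so the two points agree.\<close>

lemma invariant_orbit_closure_eq:
  assumes nint: "\<beta> \<notin> \<int>" and oc: "orbit_closure \<beta> S" and inv: "Tbar_invariant \<beta> S"
    and sub: "S \<subseteq> {1 - 1 / \<beta>..1}"
  shows "S = top_closure"
proof
  obtain x where x: "x \<in> {0..1}" and S: "S = closure (range (orbit x))"
    using oc by (auto simp: orbit_closure_def)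
  have TS: "Tbar \<beta> ` S = S" using inv by (simp add: Tbar_invariant_def)
  have inS: "(Tbar \<beta> ^^ n) x \<in> S" for n
    unfolding S by (rule subsetD[OF closure_subset]) simp
  hence orb: "(Tbar \<beta> ^^ n) x \<in> {1 - 1 / \<beta>..1}" for n using sub by (rule subsetD[rotated])
  note sl = upper_orbit_slope(1)[OF x orb]
  obtain N where N: "mechanical_word max_slope (\<lambda>n. dbar \<beta> x (n + N))"
    "\<And>n. n \<ge> N \<Longrightarrow> (Tbar \<beta> ^^ n) x \<le> top_point"
    using upper_orbit_eventually_le[OF x orb] by blast
  have top: "top_point \<in> closure (orbit x ` {N..})" by (rule top_point_in_closure[OF x sl N(2)])
  also have "\<dots> \<subseteq> S" unfolding S by (intro closure_mono) auto
  finally have "(Tbar \<beta> ^^ n) top_point \<in> S" for n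
    using funpow_image_eq[OF TS, of n] by blast
  thus sub1: "top_closure \<subseteq> S" unfolding S by (intro closure_minimal) auto
  have TC: "Tbar \<beta> ` top_closure = top_closure" by (rule top_closure_invariant[OF nint])
  have "x \<in> top_closure"
  proof (cases "max_slope \<in> \<rat>")
    case False
    thus ?thesis by (rule in_top_closure_irrational[OF x sl])
  next
    case True
    have fin: "finite (range (orbit x))" by (rule finite_orbit_rational[OF x N(1) True])
    hence Sr: "S = range (orbit x)" unfolding S by (intro closure_closed finite_imp_closed)
    have "finite (orbit x ` {N..})" by (rule finite_subset[OF _ fin]) auto
    hence "closure (orbit x ` {N..}) = orbit x ` {N..}" by (intro closure_closed finite_imp_closed)
    then obtain n where n: "top_point = (Tbar \<beta> ^^ n) x" using top by auto
    have "inj_on (Tbar \<beta>) S" by (rule finite_surj_inj) (use fin Sr TS in auto)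
    hence inj: "inj_on (Tbar \<beta> ^^ n) S" by (rule inj_on_funpow[OF _ TS])
    obtain c where c: "c \<in> top_closure" "top_point = (Tbar \<beta> ^^ n) c"
      using funpow_image_eq[OF TC, of n] top_point_in_top_closure by blast
    hence "x = c" using inj_onD[OF inj, of x c] n sub1 inS[of 0] by auto
    thus ?thesis using c(1) by simp
  qed
  hence "(Tbar \<beta> ^^ n) x \<in> top_closure" for n using funpow_image_eq[OF TC, of n] by blast
  thus "S \<subseteq> top_closure" unfolding S by (intro closure_minimal) auto
qed

text \<open>Both definite descriptions are well defined: the closure by uniqueness, the frequency
  because limits are unique and \<open>top_closure\<close> is nonempty.\<close>

lemma Freq_eq_max_slope:
  assumes "\<beta> \<notin> \<int>"
  shows "Freq \<beta> = max_slope"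
proof -
  have TC: "Tbar \<beta> ` top_closure = top_closure" by (rule top_closure_invariant[OF assms])
  have the: "(THE S. orbit_closure \<beta> S \<and> Tbar_invariant \<beta> S \<and> S \<subseteq> {1 - 1 / \<beta>..1}) = top_closure"
  proof (rule the_equality)
    have "orbit_closure \<beta> top_closure" unfolding orbit_closure_def using top_point_unit by blast
    thus "orbit_closure \<beta> top_closure \<and> Tbar_invariant \<beta> top_closure \<and> top_closure \<subseteq> {1 - 1 / \<beta>..1}"
      using TC top_closure_subset unfolding Tbar_invariant_def by blast
  next
    fix S assume "orbit_closure \<beta> S \<and> Tbar_invariant \<beta> S \<and> S \<subseteq> {1 - 1 / \<beta>..1}"
    thus "S = top_closure" using invariant_orbit_closure_eq[OF assms] by blast
  qed
  have freq: "has_frequency \<beta> z max_slope" if "z \<in> top_closure" for z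
  proof -
    have "(Tbar \<beta> ^^ n) z \<in> top_closure" for n using funpow_image_eq[OF TC, of n] that by blast
    hence orb: "(Tbar \<beta> ^^ n) z \<in> {1 - 1 / \<beta>..1}" for n using top_closure_subset by blast
    have "z \<in> {0..1}" using orb[of 0] scale_pos by auto
    thus ?thesis unfolding has_frequency_def
      by (intro has_slope_frequency upper_orbit_slope(1) orb)
  qed
  have "set_frequency \<beta> top_closure = max_slope"
    unfolding set_frequency_def
  proof (rule the_equality)
    fix f assume "\<forall>x\<in>top_closure. has_frequency \<beta> x f"
    thus "f = max_slope"
      using freq[OF top_point_in_top_closure] top_point_in_top_closure LIMSEQ_unique
      unfolding has_frequency_def by blast
  qed (use freq in blast)
  thus ?thesis using assms by (simp add: Freq_def the)
qed

text \<open>In an integer base every digit is at most \<open>\<beta> - 1\<close>; otherwise the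
  orbit lies below 1, so \<open>slope_sup \<alpha> \<le> 1\<close>.\<close>

lemma slope_le_Freq:
  assumes x: "x \<in> {0..1}" and sl: "has_slope (dbar \<beta> x) \<alpha>" and nn: "0 \<le> \<alpha>"
  shows "\<alpha> \<le> Freq \<beta>"
proof (cases "\<beta> \<in> \<int>")
  case True
  then obtain b where b: "\<beta> = real_of_int b" by (auto elim: Ints_cases)
  have "\<alpha> \<le> \<beta> - 1"
  proof (rule has_slope_mono[OF sl])
    fix n
    have "dbar \<beta> x n \<le> b - 1" using dbar_le(2)[OF x, of n] by (simp add: b)
    thus "real_of_int (dbar \<beta> x n) \<le> \<beta> - 1" by (simp add: b)
  qed
  thus ?thesis using True by (simp add: Freq_def)
next
  case False
  have "slope_sup \<alpha> \<le> 1" using orbit_unit[OF x] by (intro slope_sup_le[OF x sl]) auto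
  thus ?thesis using le_max_slope[OF nn] Freq_eq_max_slope[OF False] by simp
qed

end

theorem theorem5p1:
  fixes \<beta> \<xi> :: real
  assumes "\<beta> > 1" and "\<xi> \<in> {0..1}" and "Diam \<beta> \<xi> \<le> 1 / \<beta>"
  shows
    "(\<exists>\<alpha>. sturmian_word \<alpha> (dbar \<beta> \<xi>) \<and> \<alpha> \<le> Freq \<beta> \<and> Diam \<beta> \<xi> = 1 / \<beta>)
     \<or> (\<exists>(p::int) (q::nat). q \<ge> 1 \<and> coprime p (int q) \<and> real_of_int p / real q \<le> Freq \<beta>
          \<and> mechanical_word (real_of_int p / real q) (dbar \<beta> \<xi>)
          \<and> Diam \<beta> \<xi> = (\<beta> ^ (q - 1) - 1) / (\<beta> ^ q - 1))
     \<or> (\<exists>(p::int) (q::nat). q \<ge> 1 \<and> coprime p (int q) \<and> real_of_int p / real q \<le> Freq \<beta>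
          \<and> skew_word_of_slope (real_of_int p / real q) (dbar \<beta> \<xi>)
          \<and> (\<forall>\<^sub>F k in sequentially.
               Diam \<beta> ((Tbar \<beta> ^^ k) \<xi>) = (\<beta> ^ (q - 1) - 1) / (\<beta> ^ q - 1)))"
proof -
  interpret base \<beta> by unfold_locales (rule assms(1))
  note close = Diam_imp_close[OF assms(2,3)]
  \<comment> \<open>\<open>Tbar \<beta>\<close> sends 0 to 1, a distance greater than
    \<open>1 / \<beta>\<close>.\<close>
  have pos: "0 < \<xi>"
  proof (rule ccontr)
    assume "\<not> 0 < \<xi>"
    hence "\<xi> = 0" using assms(2) by simp
    thus False using close[of 1 0] assms(1) by (simp add: Tbar_eq)
  qed
  have bal: "sum_balanced (dbar \<beta> \<xi>)" by (rule close_imp_sum_balanced[OF close])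
  obtain \<alpha> where sl: "has_slope (dbar \<beta> \<xi>) \<alpha>" and nn: "0 \<le> \<alpha>" using close_imp_slope[OF pos close] .
  have le: "\<alpha> \<le> Freq \<beta>" by (rule slope_le_Freq[OF assms(2) sl nn])
  show ?thesis
  proof (cases "mechanical_word \<alpha> (dbar \<beta> \<xi>)")
    case mech: True
    note diam = Diam_mechanical[OF assms(2) sl mech]
    show ?thesis
    proof (cases "\<alpha> \<in> \<rat>")
      case True
      then obtain p :: int and q :: nat
        where pq: "q \<ge> 1" "coprime p (int q)" "\<alpha> = real_of_int p / real q"
        by (rule Rats_coprime_quotient)
      show ?thesis
        using pq le mech diam slope_width_rational[OF pq(1,2)]
        by (intro disjI2 disjI1 exI[of _ p] exI[of _ q]) simp
    next
      case False
      thus ?thesis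
        using le mech diam slope_width_irrational by (auto simp: sturmian_word_def)
    qed
  next
    case False
    with mechanical_or_skew[OF bal sl nn] obtain N where rat: "\<alpha> \<in> \<rat>"
      and nrec: "\<not> recurrent_word (dbar \<beta> \<xi>)" and N: "N \<ge> 1"
      and mech: "mechanical_word \<alpha> (\<lambda>n. dbar \<beta> \<xi> (n + N))" by blast
    obtain p :: int and q :: nat
      where pq: "q \<ge> 1" "coprime p (int q)" "\<alpha> = real_of_int p / real q"
      using Rats_coprime_quotient[OF rat] .
    obtain a where a: "range (dbar \<beta> \<xi>) \<subseteq> {a, a + 1}" using sum_balanced_binary[OF pos bal] .
    have skew: "skew_word_of_slope \<alpha> (dbar \<beta> \<xi>)"
      unfolding skew_word_of_slope_def skew_word_def binary_word_def
      using a sum_balanced_imp_balanced_word[OF a bal] nrec rat N mech by blast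
    \<comment> \<open>From \<open>N\<close> on the tail is mechanical, which bounds the diameter
      above; the bound below follows from the slope alone.\<close>
    have "Diam \<beta> ((Tbar \<beta> ^^ k) \<xi>) = slope_sup \<alpha> - slope_inf \<alpha>" if "k \<ge> N" for k
    proof (rule antisym)
      have shift: "has_slope (dbar \<beta> ((Tbar \<beta> ^^ k) \<xi>)) \<alpha>"
        unfolding dbar_shift by (rule has_slope_shift[OF sl])
      show "slope_sup \<alpha> - slope_inf \<alpha> \<le> Diam \<beta> ((Tbar \<beta> ^^ k) \<xi>)"
        by (rule Diam_ge_slope_width[OF orbit_unit[OF assms(2)] shift])
      have b: "slope_inf \<alpha> \<le> (Tbar \<beta> ^^ (n + k)) \<xi>" "(Tbar \<beta> ^^ (n + k)) \<xi> \<le> slope_sup \<alpha>" for n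
        using mechanical_orbit_bounds[OF orbit_unit[OF assms(2), of N], of \<alpha> "n + k - N"] mech that
        by (simp_all add: dbar_shift orbit_add)
      have "(SUP n. (Tbar \<beta> ^^ (n + k)) \<xi>) \<le> slope_sup \<alpha>" using b by (intro cSUP_least) auto
      moreover have "slope_inf \<alpha> \<le> (INF n. (Tbar \<beta> ^^ (n + k)) \<xi>)" using b by (intro cINF_greatest) auto
      ultimately show "Diam \<beta> ((Tbar \<beta> ^^ k) \<xi>) \<le> slope_sup \<alpha> - slope_inf \<alpha>"
        by (simp add: Diam_def orbit_add)
    qed
    hence "\<forall>\<^sub>F k in sequentially. Diam \<beta> ((Tbar \<beta> ^^ k) \<xi>) = (\<beta> ^ (q - 1) - 1) / (\<beta> ^ q - 1)"
      using slope_width_rational[OF pq(1,2)] pq(3) by (auto intro!: eventually_sequentiallyI[of N])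
    thus ?thesis
      using pq le skew by (intro disjI2 exI[of _ p] exI[of _ q]) simp
  qed
qed

end
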